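(* Let $\mathcal S$ be a sequent calculus as described in the context, containing the rule $(\land R)$: from $\Gamma\vdash A$ and $\Delta\vdash B$ infer $\Gamma,\Delta\vdash A\land B$. Let $A,B$ be formulae and, for all contexts (finite lists of formulae) $\vec D,\vec E$, let $\mathcal R_{\vec D,\vec E}:(\vec D\vdash A;\ \vec E\vdash B)\longrightarrow(\vec D,\vec E\vdash A\land B)$ be the multi-arrow of $\mathsf{MultiSequents}_{\mathcal S}$ given by the derivation consisting of the single instance of $(\land R)$ with premises the extra axioms $\vec D\vdash A$ and $\vec E\vdash B$. Then for all contexts $\vec D,\vec E,\vec F$ and every list of derivations $\vec\Pi:\vec E\vdash\vec F$ (an arrow of $\mathsf{Contexts}_{\mathcal S}$), the equation $$\Phi_{A\land B}(\vec D,\vec\Pi)\circ\mathcal R_{\vec D,\vec F}\;=\;\mathcal R_{\vec D,\vec E}\circ\bigl(1_{\vec D\vdash A},\ \Phi_B(\vec\Pi)\bigr)$$ between multi-arrows $(\vec D\vdash A;\ \vec F\vdash B)\longrightarrow(\vec D,\vec E\vdash A\land B)$ holds in the quotient multicategory $\mathsf{MultiSequents}_{\mathcal S}/{\equiv^{\mathrm{perm}}}$. Thus, for each fixed $\vec D$, the family $(\mathcal R_{\vec D,\vec E})_{\vec E}$ is a natural transformation, in the context variable $\Delta$, from the pair consisting of the constant functor with value $\vec D\vdash A$ and the functor $\Phi_B(\Delta)$ to the functor $\Phi_{A\land B}(\vec D,\Delta)$, where these are functors $\mathsf{Contexts}_{\mathcal S}^{\mathsf{op}}\longrightarrow\mathsf{MultiSequents}_{\mathcal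 S}/{\equiv^{\mathrm{perm}}}$.
   Context: **System.** $\mathcal S$ is a sequent calculus whose sequents $\vec A\vdash A$ consist of a finite list of formulae (context) $\vec A$ and one formula $A$. It includes the structural rules of exchange, weakening and contraction, the axiom rule $A\vdash A$ and the cut rule, and it comes with a cut-elimination procedure by which every derivation can be transformed into a normal (cut-free) one in finitely many steps. $\equiv^{\mathrm{cut}}$ is the smallest equivalence relation on derivations containing the cut-elimination conversions. Applications of exchange are left implicit. **Category of contexts.** $\mathsf{Contexts}_{\mathcal S}$ has contexts as objects. An arrow $\vec\Pi:\vec E\vdash\vec F$, with $\vec F=F_1,\dots,F_n$, is a list $\Pi_1,\dots,\Pi_n$ of derivations of $\vec E\vdash F_1,\dots,\vec E\vdash F_n$; equality of arrows is $\equiv^{\mathrm{cut}}$. Identities are the obvious derivations of $\vec E\vdash E_i$. Composition of $\vec\Pi:\vec A\vdash\vec B$ with $\vec\Sigma:\vec B\vdash\vec C$ is obtained by cutting each $\Sigma_j$ successively with all the $\Pi_i$ and then contracting the copies of $\vec A$ into one. **Multicategory of sequents.** $\mathsf{MultiSequents}_{\mathcal S}$ has sequents as objects. A multi-arrow $(\vec A_1\vdash A_1;\dots;\vec A_n\vdash A_n)\to(\vec B\vdash B)$ is a derivation of $\vec B\vdash B$ which may use the sequents $\vec A_i\vdash A_i$ as extra axioms; equality of multi-arrows is $\equiv^{\mathrm{cut}}$. The identity $1_{\vec A\vdash A}$ is the derivation consisting only of the extra axiom $\vec A\vdash A$. Composition replaces the occurrences of extra axioms by derivations of the corresponding sequents.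 **Free permutations.** Two consecutive occurrences of rules in a derivation are freely permutable when the derivation obtained by switching their order is correct and has the same conclusion (the switch may duplicate one of the two rules together with the sub-derivations above it). $\equiv^{\mathrm{perm}}$ is the family of smallest equivalence relations, on derivations with the same extra axioms and the same conclusion, closed under $\equiv^{\mathrm{cut}}$ and under free permutations of rules. It is a congruence for composition, and $\mathsf{MultiSequents}_{\mathcal S}/{\equiv^{\mathrm{perm}}}$ is the corresponding quotient multicategory. **Functors.** $\Phi_B(\vec E)$ is the sequent $\vec E\vdash B$. For $\vec\Pi:\vec E\vdash\vec F$ with $\vec F=F_1,\dots,F_n$, $\Phi_B(\vec\Pi):(\vec F\vdash B)\to(\vec E\vdash B)$ is the derivation that starts from the extra axiom $F_1,\dots,F_n\vdash B$, cuts it successively with $\Pi_n,\dots,\Pi_1$ (on $F_n,\dots,F_1$), obtaining $\vec E,\dots,\vec E\vdash B$, and then contracts to $\vec E\vdash B$. For a fixed context $\vec D$, $\Phi_{A\land B}(\vec D,\vec E)$ is the sequent $\vec D,\vec E\vdash A\land B$, and $\Phi_{A\land B}(\vec D,\vec\Pi):(\vec D,\vec F\vdash A\land B)\to(\vec D,\vec E\vdash A\land B)$ is defined in the same way: start from the extra axiom $\vec D,F_1,\dots,F_n\vdash A\land B$, cut with $\Pi_n,\dots,\Pi_1$ on $F_n,\dots,F_1$, then contract the copies of $\vec E$ into one. **Natural transformations into a multicategory.** For a category $\mathcal C$, a multicategory $\mathcal M$ and functors $F_1,\dots,F_n,G:\mathcal C\to\mathcal M$ (sending arrows to unary multi-arrows),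 a natural transformation $\theta:F_1,\dots,F_n\Rightarrow G$ is a family of multi-arrows $\theta_X:F_1(X),\dots,F_n(X)\to G(X)$ with $\theta_Y\circ(F_1(f),\dots,F_n(f))=G(f)\circ\theta_X$ for every $f:X\to Y$ in $\mathcal C$.
   Formalization: The equation is proved for every calculus; the natural-transformation claim assumes that Contexts_S is a category and that Φ_B and Φ_{A∧B}(D,–) preserve identities and composition, which can fail for an arbitrary cut-elimination procedure. *)

theory Defs
  imports Main "HOL-Combinatorics.Permutations"
begin

text \<open>A sequent \<open>(\<Gamma>, A)\<close> stands for \<open>\<Gamma> \<turnstile> A\<close>.\<close>

type_synonym 'f sequent = "'f list \<times> 'f"

datatype 'r rule_name =
  Axiom | Cut | Exchange | Weakening | Contraction | AndR | Other 'r

text \<open>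
  A rule instance records, besides its premises and its conclusion, which occurrences it acts on:
  \<open>fates \<rho> ! i ! p\<close> says whether the \<open>p\<close>-th formula in the context of the \<open>i\<close>-th premise is passed
  on to position \<open>q\<close> of the context of the conclusion (\<open>Passive q\<close>), or is used by the rule, in
  the role number \<open>k\<close> (\<open>Active k\<close>).  \<open>princ \<rho>\<close> lists the positions of the formulae which the rule
  introduces in the context of the conclusion.  Without this information it would be ambiguous,
  when a formula occurs several times in a context, which derivation is obtained by switching the
  order of two rules.
\<close>

datatype fate = Passive nat | Active nat

record ('f, 'r) inst =
  label :: "'r rule_name"
  prems :: "'f sequent list"
  concl :: "'f sequent"
  fates :: "fate list list"
  princ :: "nat list"

definition wf_inst :: "('f, 'r) inst \<Rightarrow> bool" where
  "wf_inst \<rho> \<longleftrightarrow>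
     length (fates \<rho>) = length (prems \<rho>) \<and>
     (\<forall>i < length (prems \<rho>). length (fates \<rho> ! i) = length (fst (prems \<rho> ! i))) \<and>
     (\<forall>i < length (prems \<rho>). \<forall>p < length (fst (prems \<rho> ! i)). \<forall>q. fates \<rho> ! i ! p = Passive q \<longrightarrow>
        q < length (fst (concl \<rho>)) \<and> fst (concl \<rho>) ! q = fst (prems \<rho> ! i) ! p \<and> q \<notin> set (princ \<rho>)) \<and>
     (\<forall>q < length (fst (concl \<rho>)). q \<in> set (princ \<rho>) \<or> (\<exists>t \<in> set (fates \<rho>). Passive q \<in> set t)) \<and>
     distinct (princ \<rho>) \<and> (\<forall>q \<in> set (princ \<rho>). q < length (fst (concl \<rho>)))"

definition ax_inst :: "'f \<Rightarrow> ('f, 'r) inst" where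
  "ax_inst A = \<lparr>label = Axiom, prems = [], concl = ([A], A), fates = [], princ = [0]\<rparr>"

definition cut_inst :: "'f list \<Rightarrow> 'f list \<Rightarrow> 'f \<Rightarrow> 'f list \<Rightarrow> 'f \<Rightarrow> ('f, 'r) inst" where
  "cut_inst \<Gamma> \<Delta> X \<Delta>' C =
     (let g = length \<Gamma>; d = length \<Delta>; d' = length \<Delta>' in
      \<lparr>label = Cut, prems = [(\<Gamma>, X), (\<Delta> @ X # \<Delta>', C)], concl = (\<Delta> @ \<Gamma> @ \<Delta>', C),
       fates = [map Passive [d..<d + g],
                map Passive [0..<d] @ Active 0 # map Passive [d + g..<d + g + d']],
       princ = []\<rparr>)"

text \<open>Every exchange is a reordering (see below) of one of these instances.\<close>
definition exch_inst :: "'f list \<Rightarrow> 'f \<Rightarrow> ('f, 'r) inst" where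
  "exch_inst \<Gamma> C =
     \<lparr>label = Exchange, prems = [(\<Gamma>, C)], concl = (\<Gamma>, C),
      fates = [map Passive [0..<length \<Gamma>]], princ = []\<rparr>"

definition weak_inst :: "'f list \<Rightarrow> 'f \<Rightarrow> 'f list \<Rightarrow> 'f \<Rightarrow> ('f, 'r) inst" where
  "weak_inst \<Gamma> X \<Gamma>' C =
     (let g = length \<Gamma>; g' = length \<Gamma>' in
      \<lparr>label = Weakening, prems = [(\<Gamma> @ \<Gamma>', C)], concl = (\<Gamma> @ X # \<Gamma>', C),
       fates = [map Passive [0..<g] @ map Passive [Suc g..<Suc g + g']], princ = [g]\<rparr>)"

definition contr_inst ::
    "'f list \<Rightarrow> 'f \<Rightarrow> 'f list \<Rightarrow> 'f list \<Rightarrow> 'f \<Rightarrow> ('f, 'r) inst" where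
  "contr_inst \<Gamma> X \<Gamma>' \<Gamma>'' C =
     (let g = length \<Gamma>; g' = length \<Gamma>'; g'' = length \<Gamma>'' in
      \<lparr>label = Contraction, prems = [(\<Gamma> @ X # \<Gamma>' @ X # \<Gamma>'', C)], concl = (\<Gamma> @ X # \<Gamma>' @ \<Gamma>'', C),
       fates = [map Passive [0..<g] @ Active 0 # map Passive [Suc g..<Suc g + g'] @
                Active 1 # map Passive [Suc g + g'..<Suc g + g' + g'']],
       princ = [g]\<rparr>)"

text \<open>\<open>K\<close> stands for the conjunction of \<open>A\<close> and \<open>B\<close>.\<close>
definition andR_inst :: "'f \<Rightarrow> 'f list \<Rightarrow> 'f \<Rightarrow> 'f list \<Rightarrow> 'f \<Rightarrow> ('f, 'r) inst" where
  "andR_inst K \<Gamma> A \<Delta> B =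
     (let g = length \<Gamma>; d = length \<Delta> in
      \<lparr>label = AndR, prems = [(\<Gamma>, A), (\<Delta>, B)], concl = (\<Gamma> @ \<Delta>, K),
       fates = [map Passive [0..<g], map Passive [g..<g + d]], princ = []\<rparr>)"

text \<open>
  Applications of exchange are left implicit: an instance of a rule is still considered as an
  instance of the same rule after reordering the contexts of its premises and of its conclusion.
\<close>

fun move_fate :: "(nat \<Rightarrow> nat) \<Rightarrow> fate \<Rightarrow> fate" where
  "move_fate f (Passive q) = Passive (f q)"
| "move_fate f (Active k) = Active k"

definition reorder ::
    "(nat \<Rightarrow> nat) list \<Rightarrow> (nat \<Rightarrow> nat) \<Rightarrow> ('f, 'r) inst \<Rightarrow> ('f, 'r) inst" where
  "reorder \<sigma>s \<tau> \<rho> =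
     \<lparr>label = label \<rho>,
      prems = map2 (\<lambda>\<sigma> (\<Gamma>, A). (permute_list \<sigma> \<Gamma>, A)) \<sigma>s (prems \<rho>),
      concl = (permute_list \<tau> (fst (concl \<rho>)), snd (concl \<rho>)),
      fates = map2 (\<lambda>\<sigma> t. map (move_fate (inv \<tau>)) (permute_list \<sigma> t)) \<sigma>s (fates \<rho>),
      princ = map (inv \<tau>) (princ \<rho>)\<rparr>"

text \<open>
  \<open>Ext i\<close> is an occurrence of the \<open>i\<close>-th extra axiom.  The extra axioms form a list, so that two
  extra axioms with the same sequent are distinguished.
\<close>

datatype ('f, 'r) deriv = Ext nat | Rule "('f, 'r) inst" "('f, 'r) deriv list"

text \<open>
  \<open>others\<close> contains the instances of the rules other than the structural rules, the axiom, the cut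
  and \<open>(\<and>R)\<close>, which are the same in every calculus; \<open>conv\<close> is one step of the cut-elimination
  procedure.
\<close>

record ('f, 'r) calculus =
  conjn :: "'f \<Rightarrow> 'f \<Rightarrow> 'f"
  others :: "('f, 'r) inst set"
  conv :: "('f, 'r) deriv \<Rightarrow> ('f, 'r) deriv \<Rightarrow> bool"

definition basic_rules :: "('f, 'r) calculus \<Rightarrow> ('f, 'r) inst set" where
  "basic_rules S =
     {ax_inst A | A. True} \<union>
     {cut_inst \<Gamma> \<Delta> X \<Delta>' C | \<Gamma> \<Delta> X \<Delta>' C. True} \<union>
     {exch_inst \<Gamma> C | \<Gamma> C. True} \<union>
     {weak_inst \<Gamma> X \<Gamma>' C | \<Gamma> X \<Gamma>' C. True} \<union>
     {contr_inst \<Gamma> X \<Gamma>' \<Gamma>'' C | \<Gamma> X \<Gamma>' \<Gamma>'' C. True} \<union>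
     {andR_inst (conjn S A B) \<Gamma> A \<Delta> B | A B \<Gamma> \<Delta>. True} \<union>
     others S"

definition rules :: "('f, 'r) calculus \<Rightarrow> ('f, 'r) inst set" where
  "rules S =
     {reorder \<sigma>s \<tau> \<rho> | \<sigma>s \<tau> \<rho>. \<rho> \<in> basic_rules S \<and>
        list_all2 (\<lambda>\<sigma> (\<Gamma>, _). \<sigma> permutes {..<length \<Gamma>}) \<sigma>s (prems \<rho>) \<and>
        \<tau> permutes {..<length (fst (concl \<rho>))}}"

inductive derives ::
    "('f, 'r) calculus \<Rightarrow> 'f sequent list \<Rightarrow> ('f, 'r) deriv \<Rightarrow> 'f sequent \<Rightarrow> bool"
  for S Ss where
  Ext: "i < length Ss \<Longrightarrow> derives S Ss (Ext i) (Ss ! i)"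
| Rule: "\<rho> \<in> rules S \<Longrightarrow> list_all2 (derives S Ss) ds (prems \<rho>) \<Longrightarrow>
         derives S Ss (Rule \<rho> ds) (concl \<rho>)"

primrec cut_free :: "('f, 'r) deriv \<Rightarrow> bool" where
  "cut_free (Ext i) \<longleftrightarrow> True"
| "cut_free (Rule \<rho> ds) \<longleftrightarrow> label \<rho> \<noteq> Cut \<and> list_all cut_free ds"

primrec subst :: "(nat \<Rightarrow> ('f, 'r) deriv) \<Rightarrow> ('f, 'r) deriv \<Rightarrow> ('f, 'r) deriv" where
  "subst \<sigma> (Ext i) = \<sigma> i"
| "subst \<sigma> (Rule \<rho> ds) = Rule \<rho> (map (subst \<sigma>) ds)"

text \<open>
  The conversions can be performed anywhere in a derivation and are stable under replacing extra
  axioms by derivations; this is what makes the equivalence they generate a congruence for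
  composition.  Cuts against extra axioms cannot be eliminated, hence cut elimination is required
  for derivations without extra axioms only.
\<close>

definition sequent_calculus :: "('f, 'r) calculus \<Rightarrow> bool" where
  "sequent_calculus S \<longleftrightarrow>
     (\<forall>\<rho> \<in> others S. wf_inst \<rho> \<and> (\<exists>r. label \<rho> = Other r)) \<and>
     (\<forall>d d' Ss s. conv S d d' \<longrightarrow> derives S Ss d s \<longrightarrow> derives S Ss d' s) \<and>
     (\<forall>d d' \<rho> ds es. conv S d d' \<longrightarrow> conv S (Rule \<rho> (ds @ d # es)) (Rule \<rho> (ds @ d' # es))) \<and>
     (\<forall>d d' \<sigma>. conv S d d' \<longrightarrow> conv S (subst \<sigma> d) (subst \<sigma> d')) \<and>
     (\<forall>d s. derives S [] d s \<longrightarrow> (\<exists>d'. (conv S)\<^sup>*\<^sup>* d d' \<and> cut_free d'))"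


inductive cut_eq ::
    "('f, 'r) calculus \<Rightarrow> 'f sequent list \<Rightarrow> 'f sequent \<Rightarrow> ('f, 'r) deriv \<Rightarrow> ('f, 'r) deriv \<Rightarrow> bool"
  for S Ss s where
  conv: "derives S Ss d s \<Longrightarrow> derives S Ss d' s \<Longrightarrow> conv S d d' \<Longrightarrow> cut_eq S Ss s d d'"
| refl: "derives S Ss d s \<Longrightarrow> cut_eq S Ss s d d"
| sym: "cut_eq S Ss s d d' \<Longrightarrow> cut_eq S Ss s d' d"
| trans: "cut_eq S Ss s d d' \<Longrightarrow> cut_eq S Ss s d' d'' \<Longrightarrow> cut_eq S Ss s d d''"

text \<open>
  In \<open>switchable \<rho>1 \<rho>2 k J \<rho>1' \<rho>2'\<close>, the rule \<open>\<rho>1\<close> stands above the \<open>k\<close>-th premise of \<open>\<rho>2\<close>.  After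
  switching, \<open>\<rho>1'\<close> is the lower rule, and for \<open>j \<in> J\<close> an instance \<open>\<rho>2' j\<close> of the other rule stands
  above its \<open>j\<close>-th premise.  The primed instances are applications of the same rules to the same
  occurrences of formulae: the condition compares, for every formula in the context of every
  uppermost premise, where it ends up in the conclusion or which rule uses it in which role, and
  likewise for the formulae introduced by the two rules.
\<close>

datatype two_fate = Kept nat | Used1 nat | Used2 nat

fun upper1 :: "fate \<Rightarrow> fate list \<Rightarrow> two_fate" where
  "upper1 (Active a) t = Used1 a"
| "upper1 (Passive q) t = (case t ! q of Active b \<Rightarrow> Used2 b | Passive r \<Rightarrow> Kept r)"

fun upper2 :: "fate \<Rightarrow> fate list \<Rightarrow> two_fate" where
  "upper2 (Active b) t = Used2 b"
| "upper2 (Passive q) t = (case t ! q of Active a \<Rightarrow> Used1 a | Passive r \<Rightarrow> Kept r)"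

fun only1 :: "fate \<Rightarrow> two_fate" where
  "only1 (Active a) = Used1 a"
| "only1 (Passive r) = Kept r"

fun only2 :: "fate \<Rightarrow> two_fate" where
  "only2 (Active b) = Used2 b"
| "only2 (Passive r) = Kept r"

definition switchable ::
    "('f, 'r) inst \<Rightarrow> ('f, 'r) inst \<Rightarrow> nat \<Rightarrow> nat set \<Rightarrow> ('f, 'r) inst \<Rightarrow> (nat \<Rightarrow> ('f, 'r) inst) \<Rightarrow> bool"
  where
  "switchable \<rho>1 \<rho>2 k J \<rho>1' \<rho>2' \<longleftrightarrow>
     label \<rho>1' = label \<rho>1 \<and> (\<forall>j \<in> J. label (\<rho>2' j) = label \<rho>2) \<and>
     (\<forall>j < length (prems \<rho>1).
        map (\<lambda>x. upper1 x (fates \<rho>2 ! k)) (fates \<rho>1 ! j) =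
        (if j \<in> J then map (\<lambda>x. upper2 x (fates \<rho>1' ! j)) (fates (\<rho>2' j) ! k)
         else map only1 (fates \<rho>1' ! j))) \<and>
     (\<forall>j \<in> J. \<forall>l < length (prems \<rho>2). l \<noteq> k \<longrightarrow>
        map only2 (fates \<rho>2 ! l) =
        map (\<lambda>x. upper2 x (fates \<rho>1' ! j)) (fates (\<rho>2' j) ! l)) \<and>
     map (\<lambda>q. fates \<rho>2 ! k ! q) (princ \<rho>1) = map Passive (princ \<rho>1') \<and>
     (\<forall>j \<in> J. map (\<lambda>q. fates \<rho>1' ! j ! q) (princ (\<rho>2' j)) = map Passive (princ \<rho>2))"

text \<open>
  The lower rule and its remaining premises \<open>es\<close> are duplicated when \<open>J\<close> has several elements; read
  from right to left, several copies of the upper rule are merged.  That both sides are correct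
  and have the same conclusion is required where the relation is used.
\<close>

inductive free_perm :: "('f, 'r) deriv \<Rightarrow> ('f, 'r) deriv \<Rightarrow> bool" where
  "k < length es \<Longrightarrow> J \<noteq> {} \<Longrightarrow> J \<subseteq> {..<length ds} \<Longrightarrow>
   switchable \<rho>1 \<rho>2 k J \<rho>1' \<rho>2' \<Longrightarrow>
   free_perm
     (Rule \<rho>2 (es[k := Rule \<rho>1 ds]))
     (Rule \<rho>1' (map (\<lambda>j. if j \<in> J then Rule (\<rho>2' j) (es[k := ds ! j]) else ds ! j) [0..<length ds]))"

inductive perm_eq ::
    "('f, 'r) calculus \<Rightarrow> 'f sequent list \<Rightarrow> 'f sequent \<Rightarrow> ('f, 'r) deriv \<Rightarrow> ('f, 'r) deriv \<Rightarrow> bool"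
  for S Ss where
  cut: "cut_eq S Ss s d d' \<Longrightarrow> perm_eq S Ss s d d'"
| switch: "derives S Ss d s \<Longrightarrow> derives S Ss d' s \<Longrightarrow> free_perm d d' \<Longrightarrow> perm_eq S Ss s d d'"
| inside: "derives S Ss (Rule \<rho> (ds @ d # es)) s \<Longrightarrow> perm_eq S Ss (prems \<rho> ! length ds) d d' \<Longrightarrow>
           perm_eq S Ss s (Rule \<rho> (ds @ d # es)) (Rule \<rho> (ds @ d' # es))"
| sym: "perm_eq S Ss s d d' \<Longrightarrow> perm_eq S Ss s d' d"
| trans: "perm_eq S Ss s d d' \<Longrightarrow> perm_eq S Ss s d' d'' \<Longrightarrow> perm_eq S Ss s d d''"


text \<open>
  Homs are sets with an equivalence relation which plays the role of equality of arrows.  All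
  elements of the type \<open>'o\<close> are objects.  Composition receives the objects as arguments since an
  arrow need not determine its domain.
\<close>

record ('o, 'a) cat =
  hom :: "'o \<Rightarrow> 'o \<Rightarrow> 'a set"
  heq :: "'o \<Rightarrow> 'o \<Rightarrow> 'a \<Rightarrow> 'a \<Rightarrow> bool"
  ident :: "'o \<Rightarrow> 'a"
  ccomp :: "'o \<Rightarrow> 'o \<Rightarrow> 'o \<Rightarrow> 'a \<Rightarrow> 'a \<Rightarrow> 'a"  \<comment> \<open>\<open>ccomp C X Y Z g f\<close> is \<open>g\<close> after \<open>f\<close>\<close>

definition is_equality :: "'a set \<Rightarrow> ('a \<Rightarrow> 'a \<Rightarrow> bool) \<Rightarrow> bool" where
  "is_equality H R \<longleftrightarrow> equiv H {(f, g). R f g}"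

definition is_category :: "('o, 'a) cat \<Rightarrow> bool" where
  "is_category C \<longleftrightarrow>
     (\<forall>X Y. is_equality (hom C X Y) (heq C X Y)) \<and>
     (\<forall>X. ident C X \<in> hom C X X) \<and>
     (\<forall>X Y Z. \<forall>f \<in> hom C X Y. \<forall>g \<in> hom C Y Z. ccomp C X Y Z g f \<in> hom C X Z) \<and>
     (\<forall>X Y Z f f' g g'. heq C X Y f f' \<longrightarrow> heq C Y Z g g' \<longrightarrow>
        heq C X Z (ccomp C X Y Z g f) (ccomp C X Y Z g' f')) \<and>
     (\<forall>X Y. \<forall>f \<in> hom C X Y.
        heq C X Y (ccomp C X X Y f (ident C X)) f \<and> heq C X Y (ccomp C X Y Y (ident C Y) f) f) \<and>
     (\<forall>W X Y Z. \<forall>f \<in> hom C W X. \<forall>g \<in> hom C X Y. \<forall>h \<in> hom C Y Z.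
        heq C W Z (ccomp C W Y Z h (ccomp C W X Y g f)) (ccomp C W X Z (ccomp C X Y Z h g) f))"

definition opposite :: "('o, 'a) cat \<Rightarrow> ('o, 'a) cat" where
  "opposite C =
     \<lparr>hom = (\<lambda>X Y. hom C Y X), heq = (\<lambda>X Y. heq C Y X), ident = ident C,
      ccomp = (\<lambda>X Y Z g f. ccomp C Z Y X f g)\<rparr>"

record ('o, 'a) mcat =
  mhom :: "'o list \<Rightarrow> 'o \<Rightarrow> 'a set"
  meq :: "'o list \<Rightarrow> 'o \<Rightarrow> 'a \<Rightarrow> 'a \<Rightarrow> bool"
  mident :: "'o \<Rightarrow> 'a"
  mcomp :: "'o list list \<Rightarrow> 'a \<Rightarrow> 'a list \<Rightarrow> 'a"
    \<comment> \<open>\<open>mcomp M Xss g fs\<close> is \<open>g \<circ> (f\<^sub>1, \<dots>, f\<^sub>n)\<close>, where \<open>Xss\<close> lists the domains of the \<open>f\<^sub>i\<close>\<close>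

definition mhoms :: "('o, 'a) mcat \<Rightarrow> 'o list list \<Rightarrow> 'o list \<Rightarrow> 'a list \<Rightarrow> bool" where
  "mhoms M Xss Ys fs \<longleftrightarrow> length Xss = length Ys \<and> length fs = length Ys \<and>
     (\<forall>i < length Ys. fs ! i \<in> mhom M (Xss ! i) (Ys ! i))"

definition is_multicategory :: "('o, 'a) mcat \<Rightarrow> bool" where
  "is_multicategory M \<longleftrightarrow>
     (\<forall>Xs Y. is_equality (mhom M Xs Y) (meq M Xs Y)) \<and>
     (\<forall>X. mident M X \<in> mhom M [X] X) \<and>
     (\<forall>Xss Ys Z fs. \<forall>g \<in> mhom M Ys Z. mhoms M Xss Ys fs \<longrightarrow>
        mcomp M Xss g fs \<in> mhom M (concat Xss) Z) \<and>
     (\<forall>Xss Ys Z g g' fs fs'. meq M Ys Z g g' \<longrightarrow>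
        length Xss = length Ys \<longrightarrow> length fs = length Ys \<longrightarrow> length fs' = length Ys \<longrightarrow>
        (\<forall>i < length Ys. meq M (Xss ! i) (Ys ! i) (fs ! i) (fs' ! i)) \<longrightarrow>
        meq M (concat Xss) Z (mcomp M Xss g fs) (mcomp M Xss g' fs')) \<and>
     (\<forall>Xs Y. \<forall>f \<in> mhom M Xs Y.
        meq M Xs Y (mcomp M [Xs] (mident M Y) [f]) f \<and>
        meq M Xs Y (mcomp M (map (\<lambda>X. [X]) Xs) f (map (mident M) Xs)) f) \<and>
     (\<forall>Xsss Yss Zs W fss gs. \<forall>h \<in> mhom M Zs W. mhoms M Yss Zs gs \<longrightarrow>
        length Xsss = length Zs \<longrightarrow> length fss = length Zs \<longrightarrow>
        (\<forall>i < length Zs. mhoms M (Xsss ! i) (Yss ! i) (fss ! i)) \<longrightarrow>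
        meq M (concat (concat Xsss)) W
          (mcomp M (concat Xsss) (mcomp M Yss h gs) (concat fss))
          (mcomp M (map concat Xsss) h
             (map (\<lambda>i. mcomp M (Xsss ! i) (gs ! i) (fss ! i)) [0..<length Zs])))"

record ('o, 'a, 'p, 'b) mfun =
  fobj :: "'o \<Rightarrow> 'p"
  farr :: "'o \<Rightarrow> 'o \<Rightarrow> 'a \<Rightarrow> 'b"

definition preserves_composition ::
    "('o, 'a) cat \<Rightarrow> ('p, 'b) mcat \<Rightarrow> ('o, 'a, 'p, 'b) mfun \<Rightarrow> bool" where
  "preserves_composition C M F \<longleftrightarrow>
     (\<forall>X. meq M [fobj F X] (fobj F X) (farr F X X (ident C X)) (mident M (fobj F X))) \<and>
     (\<forall>X Y Z. \<forall>f \<in> hom C X Y. \<forall>g \<in> hom C Y Z.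
        meq M [fobj F X] (fobj F Z)
          (farr F X Z (ccomp C X Y Z g f)) (mcomp M [[fobj F X]] (farr F Y Z g) [farr F X Y f]))"

definition is_functor ::
    "('o, 'a) cat \<Rightarrow> ('p, 'b) mcat \<Rightarrow> ('o, 'a, 'p, 'b) mfun \<Rightarrow> bool" where
  "is_functor C M F \<longleftrightarrow>
     is_category C \<and> is_multicategory M \<and>
     (\<forall>X Y. \<forall>f \<in> hom C X Y. farr F X Y f \<in> mhom M [fobj F X] (fobj F Y)) \<and>
     (\<forall>X Y f f'. heq C X Y f f' \<longrightarrow> meq M [fobj F X] (fobj F Y) (farr F X Y f) (farr F X Y f')) \<and>
     preserves_composition C M F"

definition const_functor :: "('p, 'b) mcat \<Rightarrow> 'p \<Rightarrow> ('o, 'a, 'p, 'b) mfun" where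
  "const_functor M P = \<lparr>fobj = (\<lambda>_. P), farr = (\<lambda>_ _ _. mident M P)\<rparr>"

definition is_natural_transformation ::
    "('o, 'a) cat \<Rightarrow> ('p, 'b) mcat \<Rightarrow> ('o, 'a, 'p, 'b) mfun list \<Rightarrow> ('o, 'a, 'p, 'b) mfun \<Rightarrow>
     ('o \<Rightarrow> 'b) \<Rightarrow> bool" where
  "is_natural_transformation C M Fs G \<theta> \<longleftrightarrow>
     (\<forall>F \<in> set Fs. is_functor C M F) \<and> is_functor C M G \<and>
     (\<forall>X. \<theta> X \<in> mhom M (map (\<lambda>F. fobj F X) Fs) (fobj G X)) \<and>
     (\<forall>X Y. \<forall>f \<in> hom C X Y.
        meq M (map (\<lambda>F. fobj F X) Fs) (fobj G Y)
          (mcomp M (map (\<lambda>F. [fobj F X]) Fs) (\<theta> Y) (map (\<lambda>F. farr F X Y f) Fs))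
          (mcomp M [map (\<lambda>F. fobj F X) Fs] (farr G X Y f) [\<theta> X]))"


text \<open>From \<open>\<Gamma>, \<Gamma>' \<turnstile> C\<close> to \<open>\<Gamma>, xs, \<Gamma>' \<turnstile> C\<close>.\<close>
fun weaken ::
    "'f list \<Rightarrow> 'f list \<Rightarrow> 'f list \<Rightarrow> 'f \<Rightarrow> ('f, 'r) deriv \<Rightarrow> ('f, 'r) deriv" where
  "weaken \<Gamma> [] \<Gamma>' C d = d"
| "weaken \<Gamma> (x # xs) \<Gamma>' C d = weaken (\<Gamma> @ [x]) xs \<Gamma>' C (Rule (weak_inst \<Gamma> x \<Gamma>' C) [d])"

text \<open>From \<open>\<Gamma>, xs, xs, \<Gamma>' \<turnstile> C\<close> to \<open>\<Gamma>, xs, \<Gamma>' \<turnstile> C\<close>.\<close>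
fun contract ::
    "'f list \<Rightarrow> 'f list \<Rightarrow> 'f list \<Rightarrow> 'f \<Rightarrow> ('f, 'r) deriv \<Rightarrow> ('f, 'r) deriv" where
  "contract \<Gamma> [] \<Gamma>' C d = d"
| "contract \<Gamma> (x # xs) \<Gamma>' C d =
     contract (\<Gamma> @ [x]) xs \<Gamma>' C (Rule (contr_inst \<Gamma> x xs (xs @ \<Gamma>') C) [d])"

text \<open>From \<open>\<Gamma>, E, \<dots>, E \<turnstile> C\<close>, with \<open>n\<close> copies of \<open>E\<close>, to \<open>\<Gamma>, E \<turnstile> C\<close>; when \<open>n = 0\<close> this is a weakening.\<close>
fun contract_copies ::
    "'f list \<Rightarrow> 'f list \<Rightarrow> nat \<Rightarrow> 'f \<Rightarrow> ('f, 'r) deriv \<Rightarrow> ('f, 'r) deriv" where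
  "contract_copies \<Gamma> E 0 C d = weaken \<Gamma> E [] C d"
| "contract_copies \<Gamma> E (Suc 0) C d = d"
| "contract_copies \<Gamma> E (Suc (Suc n)) C d =
     contract_copies \<Gamma> E (Suc n) C (contract \<Gamma> E (concat (replicate n E)) C d)"

text \<open>From \<open>\<Gamma>, F\<^sub>1, \<dots>, F\<^sub>n \<turnstile> C\<close> to \<open>\<Gamma>, E, \<dots>, E \<turnstile> C\<close>, cutting first \<open>F\<^sub>n\<close>, then \<open>F\<^sub>n\<^sub>-\<^sub>1\<close> and so on.\<close>
fun cuts ::
    "'f list \<Rightarrow> 'f list \<Rightarrow> 'f list \<Rightarrow> ('f, 'r) deriv list \<Rightarrow> 'f \<Rightarrow> ('f, 'r) deriv \<Rightarrow> ('f, 'r) deriv" where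
  "cuts E \<Gamma> (X # F) (\<pi> # \<Theta>) C d =
     Rule (cut_inst E \<Gamma> X (concat (replicate (length F) E)) C) [\<pi>, cuts E (\<Gamma> @ [X]) F \<Theta> C d]"
| "cuts E \<Gamma> _ _ C d = d"

text \<open>For \<open>\<Theta> : E \<turnstile> F\<close>, from a derivation of \<open>\<Gamma>, F \<turnstile> C\<close> to one of \<open>\<Gamma>, E \<turnstile> C\<close>.\<close>
definition cut_contract ::
    "'f list \<Rightarrow> 'f list \<Rightarrow> 'f list \<Rightarrow> ('f, 'r) deriv list \<Rightarrow> 'f \<Rightarrow> ('f, 'r) deriv \<Rightarrow> ('f, 'r) deriv" where
  "cut_contract \<Gamma> E F \<Theta> C d = contract_copies \<Gamma> E (length F) C (cuts E \<Gamma> F \<Theta> C d)"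

definition projection :: "'f list \<Rightarrow> nat \<Rightarrow> ('f, 'r) deriv" where
  "projection E i =
     weaken (take (Suc i) E) (drop (Suc i) E) [] (E ! i)
       (weaken [] (take i E) [E ! i] (E ! i) (Rule (ax_inst (E ! i)) []))"

definition Contexts :: "('f, 'r) calculus \<Rightarrow> ('f list, ('f, 'r) deriv list) cat" where
  "Contexts S =
     \<lparr>hom = (\<lambda>E F. {\<Theta>. list_all2 (\<lambda>\<pi> X. derives S [] \<pi> (E, X)) \<Theta> F}),
      heq = (\<lambda>E F \<Theta> \<Theta>'. length \<Theta> = length F \<and> length \<Theta>' = length F \<and>
               (\<forall>i < length F. cut_eq S [] (E, F ! i) (\<Theta> ! i) (\<Theta>' ! i))),
      ident = (\<lambda>E. map (projection E) [0..<length E]),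
      ccomp = (\<lambda>E F G \<Sigma> \<Theta>. map2 (\<lambda>C \<sigma>. cut_contract [] E F \<Theta> C \<sigma>) G \<Sigma>)\<rparr>"

text \<open>The \<open>i\<close>-th extra axiom of \<open>g\<close> is replaced by \<open>fs ! i\<close>, whose own extra axioms are renumbered.\<close>
definition compose ::
    "'f sequent list list \<Rightarrow> ('f, 'r) deriv \<Rightarrow> ('f, 'r) deriv list \<Rightarrow> ('f, 'r) deriv" where
  "compose Sss g fs =
     subst (\<lambda>i. subst (\<lambda>j. Ext (length (concat (take i Sss)) + j)) (fs ! i)) g"

definition MultiSequents :: "('f, 'r) calculus \<Rightarrow> ('f sequent, ('f, 'r) deriv) mcat" where
  "MultiSequents S =
     \<lparr>mhom = (\<lambda>Ss s. {d. derives S Ss d s}), meq = cut_eq S, mident = (\<lambda>_. Ext 0), mcomp = compose\<rparr>"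

definition MultiSequents_perm :: "('f, 'r) calculus \<Rightarrow> ('f sequent, ('f, 'r) deriv) mcat" where
  "MultiSequents_perm S = (MultiSequents S)\<lparr>meq := perm_eq S\<rparr>"

text \<open>
  \<open>Phi D C\<close> sends \<open>E\<close> to \<open>D, E \<turnstile> C\<close>.  It is contravariant: \<open>\<Theta> : E \<turnstile> F\<close> is an arrow from \<open>F\<close> to
  \<open>E\<close> in the opposite category.
\<close>
definition Phi ::
    "'f list \<Rightarrow> 'f \<Rightarrow> ('f list, ('f, 'r) deriv list, 'f sequent, ('f, 'r) deriv) mfun" where
  "Phi D C =
     \<lparr>fobj = (\<lambda>E. (D @ E, C)),
      farr = (\<lambda>F E \<Theta>. cut_contract D E F \<Theta> C (Ext 0))\<rparr>"

definition andR :: "('f, 'r) calculus \<Rightarrow> 'f \<Rightarrow> 'f \<Rightarrow> 'f list \<Rightarrow> 'f list \<Rightarrow> ('f, 'r) deriv" where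
  "andR S A B D E = Rule (andR_inst (conjn S A B) D A E B) [Ext 0, Ext 1]"

end

theory Submission
  imports Defs
begin

text \<open>
  If the right premise of an instance of \<open>(\<and>R)\<close> ends in a weakening, a contraction or a cut on its
  context, the two rules are freely permutable, since \<open>(\<and>R)\<close> acts on the succedents only.  Permuting
  \<open>(\<and>R)\<close> in this way above all the rules that make up \<open>\<Phi>\<^sub>B(\<Pi>)\<close> turns one side of the equation into
  the other.  The derivations in \<open>\<Pi>\<close> contain no extra axioms and are hence not affected by composition.
\<close>

section \<open>Derivability\<close>

text \<open>Both functors follow the same recipe, the second one only with \<open>D\<close> in front
  of every context. Hence each switch turns a rule over \<open>\<Gamma>\<close> into the same rule
  over \<open>D @ \<Gamma>\<close>, and once the conjunction rule has reached the extra axioms the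
  two derivations coincide literally. The obstacle is that most switches happen deep inside a
  derivation, while \<open>perm_eq\<close> is generated by single steps that demand correct
  derivations. So \<open>perm_eq\<close> has to be a congruence for every operation from which
  \<open>Phi\<close> is built, and derivability has to be carried along throughout. Likewise, that
  the quotient is a multicategory rests on the stability of both equivalences under substitution for
  extra axioms. The laws of \<open>Contexts S\<close> and the compatibility of \<open>Phi\<close>
  with composition depend on which derivations \<open>conv\<close> identifies. The conditions in
  \<open>sequent_calculus\<close> leave this open, so these facts are assumed in the second half of
  the theorem; the remaining clauses of \<open>is_functor\<close> and
  \<open>is_natural_transformation\<close> are proved.\<close>

lemma permute_list_id': "permute_list (\<lambda>x. x) xs = xs"
  by (simp add: permute_list_def map_nth)

lemma move_fate_id: "move_fate (\<lambda>x. x) = (\<lambda>x. x)"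
proof
  fix x show "move_fate (\<lambda>x. x) x = x" by (cases x) auto
qed

text \<open>\<open>rules\<close> consists of reorderings of basic instances, and the basic instances
  themselves belong to it as trivial reorderings. \<open>map2\<close> cuts the fates down to the
  number of premises; the assumption on lengths ensures that nothing is lost.\<close>

lemma reorder_id:
  assumes "length (fates \<rho>) = length (prems \<rho>)"
  shows "reorder (replicate (length (prems \<rho>)) (\<lambda>x. x)) (\<lambda>x. x) \<rho> = \<rho>"
proof -
  have inv: "inv (\<lambda>x::nat. x) = (\<lambda>x. x)"
    using inv_id by (simp add: id_def)
  have "map2 (\<lambda>\<sigma> (\<Gamma>, A). (permute_list \<sigma> \<Gamma>, A))
      (replicate (length (prems \<rho>)) (\<lambda>x. x)) (prems \<rho>) = prems \<rho>"
    by (rule nth_equalityI) (auto simp: permute_list_id' split: prod.splits)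
  moreover have "map2 (\<lambda>\<sigma> t. map (move_fate (\<lambda>x. x)) (permute_list \<sigma> t))
      (replicate (length (prems \<rho>)) (\<lambda>x. x)) (fates \<rho>) = fates \<rho>"
    using assms by (intro nth_equalityI) (auto simp: permute_list_id' move_fate_id)
  ultimately show ?thesis
    by (simp add: reorder_def inv permute_list_id')
qed

lemma basic_rules_subset:
  assumes "\<rho> \<in> basic_rules S" "length (fates \<rho>) = length (prems \<rho>)"
  shows "\<rho> \<in> rules S"
proof -
  have perm: "(\<lambda>x. x) permutes {..<n}" for n :: nat
    using permutes_id[of "{..<n}"] by (simp add: id_def)
  then have perms: "list_all2 (\<lambda>\<sigma> (\<Gamma>, _). \<sigma> permutes {..<length \<Gamma>})
      (replicate (length (prems \<rho>)) (\<lambda>x. x)) (prems \<rho>)"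
    by (auto simp: list_all2_conv_all_nth split: prod.splits)
  show ?thesis
    unfolding rules_def mem_Collect_eq
    by (intro exI conjI) (rule reorder_id[OF assms(2), symmetric] assms(1) perms perm)+
qed

lemma instances_in_rules:
  "cut_inst \<Gamma> \<Delta> X \<Delta>' C \<in> rules S"
  "weak_inst \<Gamma> X \<Gamma>' C \<in> rules S"
  "contr_inst \<Gamma> X \<Gamma>' \<Gamma>'' C \<in> rules S"
  "andR_inst (conjn S A B) \<Gamma> A \<Delta> B \<in> rules S"
proof -
  have "cut_inst \<Gamma> \<Delta> X \<Delta>' C \<in> basic_rules S" "weak_inst \<Gamma> X \<Gamma>' C \<in> basic_rules S"
    "contr_inst \<Gamma> X \<Gamma>' \<Gamma>'' C \<in> basic_rules S" "andR_inst (conjn S A B) \<Gamma> A \<Delta> B \<in> basic_rules S"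
    unfolding basic_rules_def by blast+
  then show "cut_inst \<Gamma> \<Delta> X \<Delta>' C \<in> rules S" "weak_inst \<Gamma> X \<Gamma>' C \<in> rules S"
    "contr_inst \<Gamma> X \<Gamma>' \<Gamma>'' C \<in> rules S" "andR_inst (conjn S A B) \<Gamma> A \<Delta> B \<in> rules S"
    by (auto intro!: basic_rules_subset)
      (simp_all add: cut_inst_def weak_inst_def contr_inst_def andR_inst_def Let_def)
qed

lemma prems_inst:
  "prems (cut_inst \<Gamma> \<Delta> X \<Delta>' C) = [(\<Gamma>, X), (\<Delta> @ X # \<Delta>', C)]"
  "prems (weak_inst \<Gamma> X \<Gamma>' C) = [(\<Gamma> @ \<Gamma>', C)]"
  "prems (contr_inst \<Gamma> X \<Gamma>' \<Gamma>'' C) = [(\<Gamma> @ X # \<Gamma>' @ X # \<Gamma>'', C)]"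
  by (simp_all add: cut_inst_def weak_inst_def contr_inst_def Let_def)

inductive_cases derives_ExtE: "derives S Ss (Ext i) s"
inductive_cases derives_RuleE: "derives S Ss (Rule \<rho> ds) s"

lemma derives_Rule_iff:
  "derives S Ss (Rule \<rho> ds) s \<longleftrightarrow> \<rho> \<in> rules S \<and> s = concl \<rho> \<and> list_all2 (derives S Ss) ds (prems \<rho>)"
  by (auto intro: derives.Rule elim: derives_RuleE)

lemma derives_Ext_iff: "derives S Ss (Ext i) s \<longleftrightarrow> i < length Ss \<and> s = Ss ! i"
  by (auto intro: derives.Ext elim: derives_ExtE)

lemma derives_cut_iff:
  "derives S Ss (Rule (cut_inst \<Gamma> \<Delta> X \<Delta>' C) [d, e]) s \<longleftrightarrow>
   s = (\<Delta> @ \<Gamma> @ \<Delta>', C) \<and> derives S Ss d (\<Gamma>, X) \<and> derives S Ss e (\<Delta> @ X # \<Delta>', C)"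
  by (simp add: derives_Rule_iff instances_in_rules) (simp add: cut_inst_def Let_def)

lemma derives_weak_iff:
  "derives S Ss (Rule (weak_inst \<Gamma> X \<Gamma>' C) [d]) s \<longleftrightarrow>
   s = (\<Gamma> @ X # \<Gamma>', C) \<and> derives S Ss d (\<Gamma> @ \<Gamma>', C)"
  by (simp add: derives_Rule_iff instances_in_rules) (simp add: weak_inst_def Let_def)

lemma derives_contr_iff:
  "derives S Ss (Rule (contr_inst \<Gamma> X \<Gamma>' \<Gamma>'' C) [d]) s \<longleftrightarrow>
   s = (\<Gamma> @ X # \<Gamma>' @ \<Gamma>'', C) \<and> derives S Ss d (\<Gamma> @ X # \<Gamma>' @ X # \<Gamma>'', C)"
  by (simp add: derives_Rule_iff instances_in_rules) (simp add: contr_inst_def Let_def)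

lemma derives_andR_iff:
  "derives S Ss (Rule (andR_inst (conjn S A B) \<Gamma> A \<Delta> B) [d, e]) s \<longleftrightarrow>
   s = (\<Gamma> @ \<Delta>, conjn S A B) \<and> derives S Ss d (\<Gamma>, A) \<and> derives S Ss e (\<Delta>, B)"
  by (simp add: derives_Rule_iff instances_in_rules) (simp add: andR_inst_def Let_def)

lemma derives_weaken:
  "derives S Ss d (\<Gamma> @ \<Gamma>', C) \<Longrightarrow> derives S Ss (weaken \<Gamma> xs \<Gamma>' C d) (\<Gamma> @ xs @ \<Gamma>', C)"
proof (induction xs arbitrary: \<Gamma> d)
  case (Cons x xs)
  show ?case using Cons.IH[of "Rule (weak_inst \<Gamma> x \<Gamma>' C) [d]" "\<Gamma> @ [x]"] Cons.prems
    by (simp add: derives_weak_iff)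
qed simp

lemma derives_contract:
  "derives S Ss d (\<Gamma> @ xs @ xs @ \<Gamma>', C) \<Longrightarrow> derives S Ss (contract \<Gamma> xs \<Gamma>' C d) (\<Gamma> @ xs @ \<Gamma>', C)"
proof (induction xs arbitrary: \<Gamma> d)
  case (Cons x xs)
  show ?case using Cons.IH[of "Rule (contr_inst \<Gamma> x xs (xs @ \<Gamma>') C) [d]" "\<Gamma> @ [x]"] Cons.prems
    by (simp add: derives_contr_iff)
qed simp

lemma derives_contract_copies:
  "derives S Ss d (\<Gamma> @ concat (replicate n E), C) \<Longrightarrow>
   derives S Ss (contract_copies \<Gamma> E n C d) (\<Gamma> @ E, C)"
proof (induction \<Gamma> E n C d rule: contract_copies.induct)
  case (1 \<Gamma> E C d)
  then show ?case using derives_weaken[of S Ss d \<Gamma> "[]" C E] by simp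
next
  case (3 \<Gamma> E n C d)
  then show ?case using derives_contract[of S Ss d \<Gamma> E "concat (replicate n E)" C] by simp
qed simp

lemma derives_cuts:
  "list_all2 (\<lambda>\<pi> X. derives S Ss \<pi> (E, X)) \<Theta> F \<Longrightarrow> derives S Ss d (\<Gamma> @ F, C) \<Longrightarrow>
   derives S Ss (cuts E \<Gamma> F \<Theta> C d) (\<Gamma> @ concat (replicate (length F) E), C)"
proof (induction \<Theta> F arbitrary: \<Gamma> rule: list_all2_induct)
  case (Cons \<pi> \<Theta> X F)
  then show ?case using Cons.IH[of "\<Gamma> @ [X]"] by (simp add: derives_cut_iff)
qed simp

lemma derives_cut_contract:
  "list_all2 (\<lambda>\<pi> X. derives S Ss \<pi> (E, X)) \<Theta> F \<Longrightarrow> derives S Ss d (\<Gamma> @ F, C) \<Longrightarrow>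
   derives S Ss (cut_contract \<Gamma> E F \<Theta> C d) (\<Gamma> @ E, C)"
  unfolding cut_contract_def by (intro derives_contract_copies derives_cuts)

section \<open>Substitution for extra axioms\<close>

lemma derives_subst:
  assumes "derives S Ss d s" "\<And>i. i < length Ss \<Longrightarrow> derives S Ts (\<sigma> i) (Ss ! i)"
  shows "derives S Ts (subst \<sigma> d) s"
  using assms(1)
proof induction
  case (Rule \<rho> ds)
  then show ?case by (auto simp: derives_Rule_iff list_all2_conv_all_nth)
qed (simp add: assms(2))

text \<open>Derivability bounds the indices: a derivation from \<open>Ss\<close> mentions
  \<open>Ext i\<close> only for \<open>i < length Ss\<close>. For empty \<open>Ss\<close> every
  substitution thus acts like \<open>Ext\<close>.\<close>

lemma subst_cong_derives:
  assumes "derives S Ss d s" "\<And>i. i < length Ss \<Longrightarrow> \<sigma> i = \<tau> i"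
  shows "subst \<sigma> d = subst \<tau> d"
  using assms(1)
proof induction
  case (Rule \<rho> ds)
  then show ?case by (auto simp: list_all2_conv_all_nth in_set_conv_nth)
qed (simp add: assms(2))

lemma subst_subst: "subst \<tau> (subst \<sigma> d) = subst (\<lambda>i. subst \<tau> (\<sigma> i)) d"
  by (induction d) auto

lemma subst_Ext: "subst Ext d = d"
  by (induction d) (auto simp: map_idI)

lemma subst_closed: "derives S [] d s \<Longrightarrow> subst \<sigma> d = d"
  using subst_cong_derives[of S "[]" d s \<sigma> Ext] by (simp add: subst_Ext)

lemma derives_closed: "derives S [] d s \<Longrightarrow> derives S Ss d s"
  using derives_subst[of S "[]" d s Ss Ext] by (simp add: subst_Ext)

lemma subst_weaken: "subst \<sigma> (weaken \<Gamma> xs \<Gamma>' C d) = weaken \<Gamma> xs \<Gamma>' C (subst \<sigma> d)"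
  by (induction xs arbitrary: \<Gamma> d) auto

lemma subst_contract: "subst \<sigma> (contract \<Gamma> xs \<Gamma>' C d) = contract \<Gamma> xs \<Gamma>' C (subst \<sigma> d)"
  by (induction xs arbitrary: \<Gamma> d) auto

lemma subst_contract_copies:
  "subst \<sigma> (contract_copies \<Gamma> E n C d) = contract_copies \<Gamma> E n C (subst \<sigma> d)"
  by (induction \<Gamma> E n C d rule: contract_copies.induct) (auto simp: subst_weaken subst_contract)

lemma subst_cuts:
  "subst \<sigma> (cuts E \<Gamma> F \<Theta> C d) = cuts E \<Gamma> F (map (subst \<sigma>) \<Theta>) C (subst \<sigma> d)"
  by (induction E \<Gamma> F \<Theta> C d rule: cuts.induct) auto

lemma subst_cut_contract:
  assumes "list_all2 (\<lambda>\<pi> X. derives S [] \<pi> (E, X)) \<Theta> F"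
  shows "subst \<sigma> (cut_contract \<Gamma> E F \<Theta> C d) = cut_contract \<Gamma> E F \<Theta> C (subst \<sigma> d)"
proof -
  have "map (subst \<sigma>) \<Theta> = \<Theta>"
    using assms
    by (intro map_idI) (metis in_set_conv_nth list_all2_conv_all_nth subst_closed)
  then show ?thesis
    by (simp add: cut_contract_def subst_contract_copies subst_cuts)
qed

text \<open>Switchability speaks of the rule instances only, not of the derivations above them, so
  the same instances, \<open>k\<close> and \<open>J\<close> witness the switch after
  substitution.\<close>

lemma free_perm_subst: "free_perm d d' \<Longrightarrow> free_perm (subst \<sigma> d) (subst \<sigma> d')"
proof (induction rule: free_perm.induct)
  case (1 k es J ds \<rho>1 \<rho>2 \<rho>1' \<rho>2')
  have "map (subst \<sigma>) (map (\<lambda>j. if j \<in> J then Rule (\<rho>2' j) (es[k := ds ! j]) else ds ! j) [0..<length ds])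
    = map (\<lambda>j. if j \<in> J then Rule (\<rho>2' j) ((map (subst \<sigma>) es)[k := map (subst \<sigma>) ds ! j])
        else map (subst \<sigma>) ds ! j) [0..<length (map (subst \<sigma>) ds)]"
    by (auto simp: map_update)
  then show ?case
    using free_perm.intros[of k "map (subst \<sigma>) es" J "map (subst \<sigma>) ds" \<rho>1 \<rho>2 \<rho>1' \<rho>2'] 1
    by (simp add: map_update del: map_map map_eq_conv)
qed

section \<open>The equivalences as congruences\<close>

lemma cut_eq_derives: "cut_eq S Ss s d d' \<Longrightarrow> derives S Ss d s \<and> derives S Ss d' s"
  by (induction rule: cut_eq.induct) auto

lemma perm_eq_derives: "perm_eq S Ss s d d' \<Longrightarrow> derives S Ss d s \<and> derives S Ss d' s"
proof (induction rule: perm_eq.induct)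
  case (inside \<rho> ds d es s d')
  obtain ps p qs where ps: "prems \<rho> = ps @ p # qs" "list_all2 (derives S Ss) ds ps"
    "list_all2 (derives S Ss) es qs"
    using inside.hyps(1) by (auto simp: derives_Rule_iff list_all2_append1 list_all2_Cons1)
  then have "prems \<rho> ! length ds = p"
    by (simp add: list_all2_lengthD)
  then show ?case
    using inside ps by (simp add: derives_Rule_iff list_all2_appendI)
next
  case (cut s d d')
  then show ?case by (rule cut_eq_derives)
qed simp_all

lemma perm_eq_refl: "derives S Ss d s \<Longrightarrow> perm_eq S Ss s d d"
  by (intro perm_eq.cut cut_eq.refl)

lemma cut_eq_subst:
  assumes S: "sequent_calculus S"
    and "cut_eq S Ss s d d'" "\<And>i. i < length Ss \<Longrightarrow> derives S Ts (\<sigma> i) (Ss ! i)"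
  shows "cut_eq S Ts s (subst \<sigma> d) (subst \<sigma> d')"
  using assms(2)
proof induction
  case (conv d d')
  moreover have "conv S (subst \<sigma> d) (subst \<sigma> d')"
    using S \<open>conv S d d'\<close> unfolding sequent_calculus_def by blast
  ultimately show ?case using assms(3) by (auto intro: cut_eq.conv derives_subst)
qed (use assms(3) in \<open>auto intro: cut_eq.refl cut_eq.sym cut_eq.trans derives_subst\<close>)

lemma cut_eq_closed:
  "sequent_calculus S \<Longrightarrow> cut_eq S [] s d d' \<Longrightarrow> cut_eq S Ss s d d'"
  using cut_eq_subst[of S "[]" s d d' Ss Ext] by (simp add: subst_Ext)

lemma perm_eq_subst:
  assumes S: "sequent_calculus S"
    and "perm_eq S Ss s d d'" and \<sigma>: "\<And>i. i < length Ss \<Longrightarrow> derives S Ts (\<sigma> i) (Ss ! i)"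
  shows "perm_eq S Ts s (subst \<sigma> d) (subst \<sigma> d')"
  using assms(2)
proof induction
  case (cut s d d')
  show ?case using cut_eq_subst[OF S cut \<sigma>] by (rule perm_eq.cut)
next
  case (switch d s d')
  then show ?case using \<sigma> by (auto intro: perm_eq.switch derives_subst free_perm_subst)
next
  case (inside \<rho> ds d es s d')
  then have "derives S Ts (Rule \<rho> (map (subst \<sigma>) ds @ subst \<sigma> d # map (subst \<sigma>) es)) s"
    using derives_subst[OF inside.hyps(1) \<sigma>] by simp
  then show ?case using inside perm_eq.inside by fastforce
qed (auto intro: perm_eq.sym perm_eq.trans)

text \<open>The generator \<open>inside\<close> changes one premise at a time and wants the whole
  derivation to be correct at that moment. \<open>pre\<close> collects the premises already treated,
  and the correctness of each intermediate derivation comes from the preceding step.\<close>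

lemma perm_eq_Rule_append:
  assumes "list_all2 (\<lambda>(d, d') p. perm_eq S Ss p d d') (zip ds ds') (drop (length pre) (prems \<rho>))"
    "length ds = length ds'" "derives S Ss (Rule \<rho> (pre @ ds)) s"
  shows "perm_eq S Ss s (Rule \<rho> (pre @ ds)) (Rule \<rho> (pre @ ds'))"
  using assms(2,1,3)
proof (induction ds ds' arbitrary: pre rule: list_induct2)
  case Nil
  then show ?case by (simp add: perm_eq_refl)
next
  case (Cons d ds d' ds')
  obtain p ps where p: "drop (length pre) (prems \<rho>) = p # ps" "perm_eq S Ss p d d'"
    "list_all2 (\<lambda>(d, d') p. perm_eq S Ss p d d') (zip ds ds') ps"
    using Cons.prems(1) by (auto simp: list_all2_Cons1)
  then have "prems \<rho> ! length pre = p"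
    by (metis nth_via_drop)
  then have 1: "perm_eq S Ss s (Rule \<rho> (pre @ d # ds)) (Rule \<rho> (pre @ d' # ds))"
    using Cons.prems(2) p(2) by (auto intro: perm_eq.inside)
  moreover have "drop (length (pre @ [d'])) (prems \<rho>) = ps"
    using p(1) by (metis length_append_singleton drop_Suc list.sel(3) tl_drop)
  then have "perm_eq S Ss s (Rule \<rho> ((pre @ [d']) @ ds)) (Rule \<rho> ((pre @ [d']) @ ds'))"
    using Cons.IH[of "pre @ [d']"] p(3) perm_eq_derives[OF 1] by simp
  ultimately show ?case by (auto intro: perm_eq.trans)
qed

lemma perm_eq_Rule:
  assumes "derives S Ss (Rule \<rho> ds) s" "length ds' = length ds"
    "\<And>i. i < length ds \<Longrightarrow> perm_eq S Ss (prems \<rho> ! i) (ds ! i) (ds' ! i)"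
  shows "perm_eq S Ss s (Rule \<rho> ds) (Rule \<rho> ds')"
proof -
  have "length (prems \<rho>) = length ds"
    using assms(1) by (auto simp: derives_Rule_iff dest: list_all2_lengthD)
  then have "list_all2 (\<lambda>(d, d') p. perm_eq S Ss p d d') (zip ds ds') (drop (length []) (prems \<rho>))"
    by (simp add: list_all2_conv_all_nth assms)
  from perm_eq_Rule_append[OF this assms(2)[symmetric]] show ?thesis
    using assms(1) by simp
qed

lemma perm_eq_subst_right:
  assumes "derives S Ss d s" "\<And>i. i < length Ss \<Longrightarrow> perm_eq S Ts (Ss ! i) (\<sigma> i) (\<tau> i)"
  shows "perm_eq S Ts s (subst \<sigma> d) (subst \<tau> d)"
  using assms(1)
proof induction
  case (Rule \<rho> ds)
  have "list_all2 (derives S Ss) ds (prems \<rho>)"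
    using Rule.IH by (auto elim: list_all2_mono)
  then have "derives S Ts (subst \<sigma> (Rule \<rho> ds)) (concl \<rho>)"
    using Rule.hyps assms(2)[THEN perm_eq_derives] by (intro derives_subst[OF derives.Rule]) auto
  then show ?case
    using Rule by (auto intro!: perm_eq_Rule simp: list_all2_conv_all_nth)
qed (simp add: assms(2))

lemma is_equality_perm_eq: "is_equality {d. derives S Ss d s} (perm_eq S Ss s)"
  unfolding is_equality_def
  by (rule equivI)
    (use perm_eq_derives[of S Ss s] in \<open>auto simp: perm_eq_refl intro!: refl_onI symI transI
      intro: perm_eq.sym perm_eq.trans\<close>)

section \<open>Congruence for the operations from which the functors are built\<close>

lemma perm_eq_cut:
  assumes "perm_eq S Ss (E, X) \<pi> \<pi>'" "perm_eq S Ss (\<Gamma> @ X # \<Gamma>', C) d d'"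
  shows "perm_eq S Ss (\<Gamma> @ E @ \<Gamma>', C)
    (Rule (cut_inst E \<Gamma> X \<Gamma>' C) [\<pi>, d]) (Rule (cut_inst E \<Gamma> X \<Gamma>' C) [\<pi>', d'])"
  using assms perm_eq_derives[OF assms(1)] perm_eq_derives[OF assms(2)]
  by (intro perm_eq_Rule) (auto simp: derives_cut_iff less_Suc_eq nth_Cons' prems_inst)

lemma perm_eq_weaken:
  "perm_eq S Ss (\<Gamma> @ \<Gamma>', C) d d' \<Longrightarrow>
   perm_eq S Ss (\<Gamma> @ xs @ \<Gamma>', C) (weaken \<Gamma> xs \<Gamma>' C d) (weaken \<Gamma> xs \<Gamma>' C d')"
proof (induction xs arbitrary: \<Gamma> d d')
  case (Cons x xs)
  have "perm_eq S Ss (\<Gamma> @ x # \<Gamma>', C) (Rule (weak_inst \<Gamma> x \<Gamma>' C) [d]) (Rule (weak_inst \<Gamma> x \<Gamma>' C) [d'])"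
    using Cons.prems perm_eq_derives[OF Cons.prems]
    by (intro perm_eq_Rule) (auto simp: derives_weak_iff prems_inst)
  then show ?case using Cons.IH[of "\<Gamma> @ [x]"] by simp
qed simp

lemma perm_eq_contract:
  "perm_eq S Ss (\<Gamma> @ xs @ xs @ \<Gamma>', C) d d' \<Longrightarrow>
   perm_eq S Ss (\<Gamma> @ xs @ \<Gamma>', C) (contract \<Gamma> xs \<Gamma>' C d) (contract \<Gamma> xs \<Gamma>' C d')"
proof (induction xs arbitrary: \<Gamma> d d')
  case (Cons x xs)
  let ?\<rho> = "contr_inst \<Gamma> x xs (xs @ \<Gamma>') C"
  have "perm_eq S Ss (\<Gamma> @ x # xs @ xs @ \<Gamma>', C) (Rule ?\<rho> [d]) (Rule ?\<rho> [d'])"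
    using Cons.prems perm_eq_derives[OF Cons.prems]
    by (intro perm_eq_Rule) (auto simp: derives_contr_iff prems_inst)
  then show ?case using Cons.IH[of "\<Gamma> @ [x]"] by simp
qed simp

lemma perm_eq_contract_copies:
  "perm_eq S Ss (\<Gamma> @ concat (replicate n E), C) d d' \<Longrightarrow>
   perm_eq S Ss (\<Gamma> @ E, C) (contract_copies \<Gamma> E n C d) (contract_copies \<Gamma> E n C d')"
proof (induction \<Gamma> E n C d arbitrary: d' rule: contract_copies.induct)
  case (1 \<Gamma> E C d)
  then show ?case using perm_eq_weaken[of S Ss \<Gamma> "[]" C d d' E] by simp
next
  case (3 \<Gamma> E n C d)
  then show ?case using perm_eq_contract[of S Ss \<Gamma> E "concat (replicate n E)" C d d'] by simp
qed simp

text \<open>The derivations that are cut in may vary too: this is what makes equal arrows of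
  contexts have equal images under \<open>Phi\<close>.\<close>

lemma perm_eq_cuts:
  assumes "length \<Theta> = length F" "length \<Theta>' = length F"
    "\<And>i. i < length F \<Longrightarrow> perm_eq S Ss (E, F ! i) (\<Theta> ! i) (\<Theta>' ! i)"
    "perm_eq S Ss (\<Gamma> @ F, C) d d'"
  shows "perm_eq S Ss (\<Gamma> @ concat (replicate (length F) E), C) (cuts E \<Gamma> F \<Theta> C d) (cuts E \<Gamma> F \<Theta>' C d')"
  using assms
proof (induction F arbitrary: \<Gamma> \<Theta> \<Theta>')
  case (Cons X F)
  obtain \<pi> \<Theta>1 \<pi>' \<Theta>1' where \<Theta>: "\<Theta> = \<pi> # \<Theta>1" "\<Theta>' = \<pi>' # \<Theta>1'"
    using Cons.prems(1,2) by (metis length_Suc_conv)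
  have "perm_eq S Ss ((\<Gamma> @ [X]) @ concat (replicate (length F) E), C)
      (cuts E (\<Gamma> @ [X]) F \<Theta>1 C d) (cuts E (\<Gamma> @ [X]) F \<Theta>1' C d')"
  proof (rule Cons.IH)
    show "perm_eq S Ss (E, F ! i) (\<Theta>1 ! i) (\<Theta>1' ! i)" if "i < length F" for i
      using Cons.prems(3)[of "Suc i"] that \<Theta> by simp
  qed (use Cons.prems \<Theta> in auto)
  moreover have "perm_eq S Ss (E, X) \<pi> \<pi>'"
    using Cons.prems(3)[of 0] \<Theta> by simp
  ultimately show ?case using \<Theta> by (auto intro: perm_eq_cut)
qed simp

section \<open>The multicategory of sequents modulo permutations\<close>

text \<open>The extra axioms of a composite are numbered block by block;
  \<open>length (concat (take i xss))\<close> is the shift that \<open>compose\<close> applies to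
  the \<open>i\<close>-th derivation.\<close>

lemma nth_concat_offset:
  "i < length xss \<Longrightarrow> j < length (xss ! i) \<Longrightarrow>
   length (concat (take i xss)) + j < length (concat xss) \<and>
   concat xss ! (length (concat (take i xss)) + j) = xss ! i ! j"
proof (induction xss arbitrary: i)
  case (Cons xs xss)
  then show ?case by (cases i) (auto simp: nth_append)
qed simp

text \<open>For composites nested twice: what precedes block \<open>j\<close> of group
  \<open>i\<close> is all the earlier groups and the earlier blocks of the same group.\<close>

lemma take_concat_offset:
  "i < length xss \<Longrightarrow> j \<le> length (xss ! i) \<Longrightarrow>
   take (length (concat (take i xss)) + j) (concat xss) = concat (take i xss) @ take j (xss ! i)"
proof (induction xss arbitrary: i)
  case (Cons xs xss)
  then show ?case by (cases i) auto
qed simp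

lemma concat_map_concat: "concat (map concat xsss) = concat (concat xsss)"
  by (induction xsss) auto

lemma length_concat_take_cong:
  assumes "length xss = length yss" "\<And>i. i < length xss \<Longrightarrow> length (xss ! i) = length (yss ! i)"
  shows "length (concat (take i xss)) = length (concat (take i yss))"
proof -
  have "map length xss = map length yss"
    using assms by (intro nth_equalityI) auto
  then show ?thesis by (metis length_concat take_map)
qed

lemma derives_renumbered:
  assumes "i < length Xss" "derives S (Xss ! i) d s"
  shows "derives S (concat Xss) (subst (\<lambda>j. Ext (length (concat (take i Xss)) + j)) d) s"
  using assms(2) by (rule derives_subst) (use nth_concat_offset[OF assms(1)] in \<open>simp add: derives_Ext_iff\<close>)

lemma derives_compose:
  assumes "derives S Ys g Z" "length Xss = length Ys"
    "\<And>i. i < length Ys \<Longrightarrow> derives S (Xss ! i) (fs ! i) (Ys ! i)"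
  shows "derives S (concat Xss) (compose Xss g fs) Z"
  unfolding compose_def using assms by (auto intro!: derives_subst[OF assms(1)] derives_renumbered)

text \<open>Changing \<open>g\<close> is stability under substitution; changing \<open>fs\<close> is
  a congruence argument along the derivation \<open>g'\<close>.\<close>

lemma perm_eq_compose:
  assumes S: "sequent_calculus S" and g: "perm_eq S Ys Z g g'" and len: "length Xss = length Ys"
    and f: "\<And>i. i < length Ys \<Longrightarrow> perm_eq S (Xss ! i) (Ys ! i) (fs ! i) (fs' ! i)"
  shows "perm_eq S (concat Xss) Z (compose Xss g fs) (compose Xss g' fs')"
proof (rule perm_eq.trans)
  show "perm_eq S (concat Xss) Z (compose Xss g fs) (compose Xss g' fs)"
    unfolding compose_def using g
    by (rule perm_eq_subst[OF S]) (use f len in \<open>auto dest: perm_eq_derives intro!: derives_renumbered\<close>)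
  show "perm_eq S (concat Xss) Z (compose Xss g' fs) (compose Xss g' fs')"
    unfolding compose_def
  proof (rule perm_eq_subst_right)
    fix i assume i: "i < length Ys"
    show "perm_eq S (concat Xss) (Ys ! i)
        (subst (\<lambda>j. Ext (length (concat (take i Xss)) + j)) (fs ! i))
        (subst (\<lambda>j. Ext (length (concat (take i Xss)) + j)) (fs' ! i))"
      using f[OF i] by (rule perm_eq_subst[OF S])
        (use i len in \<open>auto simp: derives_Ext_iff nth_concat_offset\<close>)
  qed (use g in \<open>simp add: perm_eq_derives\<close>)
qed

lemma compose_Ext0: "compose [Xs] (Ext 0) [f] = f"
proof -
  have "subst (\<lambda>j. Ext j) f = f" by (rule subst_Ext)
  then show ?thesis by (simp add: compose_def)
qed

lemma compose_idents:
  assumes "derives S Xs f Y"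
  shows "compose (map (\<lambda>X. [X]) Xs) f (map (\<lambda>_. Ext 0) Xs) = f"
proof -
  have "length (concat (take i (map (\<lambda>X. [X]) Xs))) = i" if "i < length Xs" for i
    using that by (simp add: take_map)
  then show ?thesis
    unfolding compose_def using subst_cong_derives[OF assms, of _ Ext]
    by (simp add: subst_Ext)
qed

text \<open>Associativity holds literally: both sides are iterated substitutions, which
  \<open>subst_subst\<close> fuses. What remains is that the \<open>j\<close>-th axiom of
  \<open>gs ! i\<close> receives the same derivation on both sides, with the same total
  shift.\<close>

lemma compose_assoc:
  assumes h: "derives S Zs h W"
    and len: "length Yss = length Zs" "length gs = length Zs" "length Xsss = length Zs" "length fss = length Zs"
    and g: "\<And>i. i < length Zs \<Longrightarrow> derives S (Yss ! i) (gs ! i) (Zs ! i)"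
    and lens: "\<And>i. i < length Zs \<Longrightarrow> length (Xsss ! i) = length (Yss ! i)"
      "\<And>i. i < length Zs \<Longrightarrow> length (fss ! i) = length (Yss ! i)"
  shows "compose (concat Xsss) (compose Yss h gs) (concat fss) =
    compose (map concat Xsss) h (map (\<lambda>i. compose (Xsss ! i) (gs ! i) (fss ! i)) [0..<length Zs])"
proof -
  let ?off = "\<lambda>i. length (concat (take i Yss))"
  have "subst (\<lambda>k. Ext (length (concat (take (?off i + j) (concat Xsss))) + k)) (concat fss ! (?off i + j))
      = subst (\<lambda>k. Ext (length (concat (take i (map concat Xsss))) + k))
         (subst (\<lambda>k. Ext (length (concat (take j (Xsss ! i))) + k)) (fss ! i ! j))"
    if i: "i < length Zs" and j: "j < length (Yss ! i)" for i j
  proof -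
    \<comment> \<open>A shift depends only on the lengths of the blocks, so \<open>Yss\<close>,
      \<open>fss\<close> and \<open>Xsss\<close> all give the same one.\<close>
    have "?off i = length (concat (take i fss))"
      by (rule length_concat_take_cong) (use len lens in auto)
    then have f: "concat fss ! (?off i + j) = fss ! i ! j"
      using nth_concat_offset[of i fss j] i j len lens by simp
    have "?off i = length (concat (take i Xsss))"
      by (rule length_concat_take_cong) (use len lens in auto)
    then have "take (?off i + j) (concat Xsss) = concat (take i Xsss) @ take j (Xsss ! i)"
      using take_concat_offset[of i Xsss j] i j len lens by simp
    then show ?thesis
      by (simp add: f subst_subst take_map concat_map_concat add.assoc)
  qed
  then have "subst (\<lambda>l. subst (\<lambda>k. Ext (length (concat (take l (concat Xsss))) + k)) (concat fss ! l))
        (subst (\<lambda>j. Ext (?off i + j)) (gs ! i))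
      = subst (\<lambda>k. Ext (length (concat (take i (map concat Xsss))) + k)) (compose (Xsss ! i) (gs ! i) (fss ! i))"
    if "i < length Zs" for i
    unfolding compose_def subst_subst using that
    by (auto intro!: subst_cong_derives[OF g[OF that]] simp: subst_subst)
  then show ?thesis
    unfolding compose_def[of "concat Xsss"] compose_def[of Yss] compose_def[of "map concat Xsss"] subst_subst
    by (intro subst_cong_derives[OF h]) (simp add: subst_subst)
qed

lemma MultiSequents_perm_simps:
  "mhom (MultiSequents_perm S) Ss s = {d. derives S Ss d s}"
  "meq (MultiSequents_perm S) = perm_eq S"
  "mident (MultiSequents_perm S) = (\<lambda>_. Ext 0)"
  "mcomp (MultiSequents_perm S) = compose"
  by (simp_all add: MultiSequents_perm_def MultiSequents_def)

lemma is_multicategory_MultiSequents_perm: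
  assumes "sequent_calculus S"
  shows "is_multicategory (MultiSequents_perm S)"
  unfolding is_multicategory_def MultiSequents_perm_simps mhoms_def
proof (intro conjI allI ballI impI)
  fix Xsss Yss Zs W fss gs h
  assume h: "h \<in> {d. derives S Zs d W}"
    and g: "length Yss = length Zs \<and> length gs = length Zs \<and>
      (\<forall>i<length Zs. gs ! i \<in> {d. derives S (Yss ! i) d (Zs ! i)})"
    and len: "length Xsss = length Zs" "length fss = length Zs"
    and f: "\<forall>i<length Zs. length (Xsss ! i) = length (Yss ! i) \<and> length (fss ! i) = length (Yss ! i) \<and>
      (\<forall>j<length (Yss ! i). fss ! i ! j \<in> {d. derives S (Xsss ! i ! j) d (Yss ! i ! j)})"
  \<comment> \<open>The two sides are the same derivation, but \<open>perm_eq\<close> is reflexive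
    on correct derivations only.\<close>
  have "derives S (concat (map concat Xsss))
      (compose (map concat Xsss) h (map (\<lambda>i. compose (Xsss ! i) (gs ! i) (fss ! i)) [0..<length Zs])) W"
    using h g len f by (auto intro!: derives_compose)
  then show "perm_eq S (concat (concat Xsss)) W
      (compose (concat Xsss) (compose Yss h gs) (concat fss))
      (compose (map concat Xsss) h (map (\<lambda>i. compose (Xsss ! i) (gs ! i) (fss ! i)) [0..<length Zs]))"
    using compose_assoc[of S Zs h W Yss gs Xsss fss] h g len f
    by (simp add: perm_eq_refl concat_map_concat)
qed (use assms in \<open>auto simp: is_equality_perm_eq derives_Ext_iff compose_Ext0 compose_idents perm_eq_refl
    intro!: derives_compose perm_eq_compose\<close>)

section \<open>The functors\<close>

lemma is_equality_refl: "is_equality H R \<Longrightarrow> f \<in> H \<Longrightarrow> R f f"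
  unfolding is_equality_def equiv_def refl_on_def by blast

lemma is_equality_sym: "is_equality H R \<Longrightarrow> R f g \<Longrightarrow> R g f"
  unfolding is_equality_def equiv_def sym_def by blast

lemma is_category_opposite:
  assumes "is_category C"
  shows "is_category (opposite C)"
proof -
  note C = assms[unfolded is_category_def]
  note eq = C[THEN conjunct1, rule_format]
  note id = C[THEN conjunct2, THEN conjunct1, rule_format]
  note C2 = C[THEN conjunct2, THEN conjunct2]
  note comp = C2[THEN conjunct1, rule_format]
  note cong = C2[THEN conjunct2, THEN conjunct1, rule_format]
  note unit = C2[THEN conjunct2, THEN conjunct2, THEN conjunct1, rule_format]
  note assoc = C2[THEN conjunct2, THEN conjunct2, THEN conjunct2, rule_format]
  show ?thesis
    unfolding is_category_def opposite_def cat.simps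
  proof (intro conjI allI ballI impI)
    show "is_equality (hom C Y X) (heq C Y X)" for X Y by (rule eq)
    show "ident C X \<in> hom C X X" for X by (rule id)
    show "ccomp C Z Y X f g \<in> hom C Z X" if "f \<in> hom C Y X" "g \<in> hom C Z Y" for X Y Z f g
      using that by (intro comp)
    show "heq C Z X (ccomp C Z Y X f g) (ccomp C Z Y X f' g')"
      if "heq C Y X f f'" "heq C Z Y g g'" for X Y Z f f' g g'
      using that by (intro cong)
    show "heq C Y X (ccomp C Y X X (ident C X) f) f" "heq C Y X (ccomp C Y Y X f (ident C Y)) f"
      if "f \<in> hom C Y X" for X Y f
      using unit[OF that] by auto
    \<comment> \<open>Reversing arrows exchanges the two bracketings, hence the use of
      symmetry.\<close>
    show "heq C Z W (ccomp C Z Y W (ccomp C Y X W f g) h) (ccomp C Z X W f (ccomp C Z Y X g h))"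
      if "f \<in> hom C X W" "g \<in> hom C Y X" "h \<in> hom C Z Y" for W X Y Z f g h
      by (rule is_equality_sym[OF eq assoc[OF that(3,2,1)]])
  qed
qed

lemma is_functor_const:
  assumes C: "is_category C" and M: "is_multicategory M"
  shows "is_functor C M (const_functor M P)"
proof -
  note M' = M[unfolded is_multicategory_def]
  note eq = M'[THEN conjunct1, rule_format]
  note id = M'[THEN conjunct2, THEN conjunct1, rule_format]
  note unit = M'[THEN conjunct2, THEN conjunct2, THEN conjunct2, THEN conjunct2, THEN conjunct1,
    rule_format, THEN conjunct1]
  have "meq M [P] P (mident M P) (mident M P)"
    by (rule is_equality_refl[OF eq id])
  moreover have "meq M [P] P (mident M P) (mcomp M [[P]] (mident M P) [mident M P])"
    by (rule is_equality_sym[OF eq unit[OF id]])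
  ultimately show ?thesis
    using C M id by (simp add: is_functor_def const_functor_def preserves_composition_def)
qed

text \<open>Arrows of contexts and their equality are closed, that is, free of extra axioms, whereas
  their images live over the extra axiom \<open>(D @ X, C)\<close>. The point is that closed
  derivations and closed equivalences remain valid over any extra axioms.\<close>

lemma is_functor_Phi:
  assumes S: "sequent_calculus S" and C: "is_category (Contexts S)"
    and pres: "preserves_composition (opposite (Contexts S)) (MultiSequents_perm S) (Phi D C)"
  shows "is_functor (opposite (Contexts S)) (MultiSequents_perm S) (Phi D C)"
  unfolding is_functor_def
proof (intro conjI allI ballI impI)
  fix X Y \<Theta> assume "\<Theta> \<in> hom (opposite (Contexts S)) X Y"
  then have "list_all2 (\<lambda>\<pi> Z. derives S [(D @ X, C)] \<pi> (Y, Z)) \<Theta> X"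
    by (auto simp: opposite_def Contexts_def derives_closed elim: list_all2_mono)
  then show "farr (Phi D C) X Y \<Theta>
      \<in> mhom (MultiSequents_perm S) [fobj (Phi D C) X] (fobj (Phi D C) Y)"
    by (simp add: Phi_def MultiSequents_perm_simps derives_cut_contract derives_Ext_iff)
next
  fix X Y \<Theta> \<Theta>' assume "heq (opposite (Contexts S)) X Y \<Theta> \<Theta>'"
  then have \<Theta>: "length \<Theta> = length X" "length \<Theta>' = length X"
    "\<And>i. i < length X \<Longrightarrow> cut_eq S [] (Y, X ! i) (\<Theta> ! i) (\<Theta>' ! i)"
    by (simp_all add: opposite_def Contexts_def)
  have "perm_eq S [(D @ X, C)] (Y, X ! i) (\<Theta> ! i) (\<Theta>' ! i)" if "i < length X" for i
    using cut_eq_closed[OF S \<Theta>(3)[OF that]] by (rule perm_eq.cut)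
  moreover have "perm_eq S [(D @ X, C)] (D @ X, C) (Ext 0) (Ext 0)"
    by (rule perm_eq_refl) (simp add: derives_Ext_iff)
  ultimately have "perm_eq S [(D @ X, C)] (D @ Y, C)
      (cut_contract D Y X \<Theta> C (Ext 0)) (cut_contract D Y X \<Theta>' C (Ext 0))"
    unfolding cut_contract_def using \<Theta>(1,2) by (intro perm_eq_contract_copies perm_eq_cuts)
  then show "meq (MultiSequents_perm S) [fobj (Phi D C) X] (fobj (Phi D C) Y)
      (farr (Phi D C) X Y \<Theta>) (farr (Phi D C) X Y \<Theta>')"
    by (simp add: Phi_def MultiSequents_perm_simps)
qed (use assms in \<open>simp_all add: is_category_opposite is_multicategory_MultiSequents_perm\<close>)

section \<open>Permuting the conjunction rule\<close>

lemma free_perm_andR_unary: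
  assumes "switchable \<rho>1 (andR_inst K D A \<Delta> B) 1 {0} \<rho>1' (\<lambda>_. andR_inst K D A \<Delta>' B)"
  shows "free_perm (Rule (andR_inst K D A \<Delta> B) [e, Rule \<rho>1 [d]])
    (Rule \<rho>1' [Rule (andR_inst K D A \<Delta>' B) [e, d]])"
  \<comment> \<open>The entry \<open>d\<close> of \<open>[e, d]\<close> is a placeholder: it is
    overwritten on both sides of the switch.\<close>
  using free_perm.intros[of 1 "[e, d]" "{0}" "[d]", OF _ _ _ assms] by simp

text \<open>The conjunction rule uses no formula of a context and introduces none; all it does to
  the right context is to shift it by \<open>length D\<close>. Putting \<open>D\<close> in front of
  \<open>\<Gamma>\<close> in the other rule reproduces this shift, so every formula has the same
  fate in both orders. The next two lemmas hold for the same reason.\<close>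

lemma free_perm_andR_weak:
  "free_perm (Rule (andR_inst K D A (\<Gamma> @ x # \<Gamma>') B) [e, Rule (weak_inst \<Gamma> x \<Gamma>' B) [d]])
     (Rule (weak_inst (D @ \<Gamma>) x \<Gamma>' K) [Rule (andR_inst K D A (\<Gamma> @ \<Gamma>') B) [e, d]])"
  by (rule free_perm_andR_unary,
      simp add: switchable_def weak_inst_def andR_inst_def Let_def nth_append del: upt_Suc)
    (intro conjI nth_equalityI; auto simp: nth_append nth_Cons' simp del: upt_Suc)+

lemma free_perm_andR_contr:
  "free_perm
     (Rule (andR_inst K D A (\<Gamma> @ x # \<Gamma>' @ \<Gamma>'') B) [e, Rule (contr_inst \<Gamma> x \<Gamma>' \<Gamma>'' B) [d]])
     (Rule (contr_inst (D @ \<Gamma>) x \<Gamma>' \<Gamma>'' K)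
        [Rule (andR_inst K D A (\<Gamma> @ x # \<Gamma>' @ x # \<Gamma>'') B) [e, d]])"
  by (rule free_perm_andR_unary,
      simp add: switchable_def contr_inst_def andR_inst_def Let_def nth_append del: upt_Suc)
    (intro conjI nth_equalityI; auto simp: nth_append nth_Cons' simp del: upt_Suc)+

text \<open>The conjunction rule has to go above the right premise of the cut, the one with
  succedent \<open>B\<close>, whence \<open>J = {1}\<close>. The left premise \<open>\<pi>\<close>
  stays directly above the cut, and nothing is duplicated.\<close>

lemma free_perm_andR_cut:
  "free_perm
     (Rule (andR_inst K D A (\<Gamma> @ E @ \<Gamma>') B) [e, Rule (cut_inst E \<Gamma> X \<Gamma>' B) [\<pi>, d]])
     (Rule (cut_inst E (D @ \<Gamma>) X \<Gamma>' K) [\<pi>, Rule (andR_inst K D A (\<Gamma> @ X # \<Gamma>') B) [e, d]])"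
proof -
  have "switchable (cut_inst E \<Gamma> X \<Gamma>' B) (andR_inst K D A (\<Gamma> @ E @ \<Gamma>') B) 1 {1}
      (cut_inst E (D @ \<Gamma>) X \<Gamma>' K) (\<lambda>_. andR_inst K D A (\<Gamma> @ X # \<Gamma>') B)"
    by (simp add: switchable_def cut_inst_def andR_inst_def Let_def nth_append less_Suc_eq
        all_conj_distrib del: upt_Suc)
      (intro conjI nth_equalityI; auto simp: nth_append nth_Cons' simp del: upt_Suc)+
  then show ?thesis
    using free_perm.intros[of 1 "[e, d]" "{1}" "[\<pi>, d]"] by (simp add: numeral_2_eq_2)
qed

section \<open>The conjunction rule against whole blocks of structural rules and cuts\<close>

context
  fixes S :: "('f, 'r) calculus" and A B :: 'f and Ss D e
  assumes e: "derives S Ss e (D, A)"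
begin

abbreviation conj_with :: "'f list \<Rightarrow> ('f, 'r) deriv \<Rightarrow> ('f, 'r) deriv" where
  "conj_with \<Delta> d \<equiv> Rule (andR_inst (conjn S A B) D A \<Delta> B) [e, d]"

text \<open>\<open>weaken\<close> applies its first weakening innermost. So the induction
  hypothesis, with prefix \<open>\<Gamma> @ [x]\<close>, passes all the other weakenings, and the
  innermost one is switched last, inside them, by \<open>perm_eq_weaken\<close>.\<close>

lemma conj_with_weaken:
  "derives S Ss d (\<Gamma> @ \<Gamma>', B) \<Longrightarrow>
   perm_eq S Ss (D @ \<Gamma> @ xs @ \<Gamma>', conjn S A B) (conj_with (\<Gamma> @ xs @ \<Gamma>') (weaken \<Gamma> xs \<Gamma>' B d))
     (weaken (D @ \<Gamma>) xs \<Gamma>' (conjn S A B) (conj_with (\<Gamma> @ \<Gamma>') d))"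
proof (induction xs arbitrary: \<Gamma> d)
  case Nil
  then show ?case using e by (simp add: perm_eq_refl derives_andR_iff)
next
  case (Cons x xs)
  let ?d = "Rule (weak_inst \<Gamma> x \<Gamma>' B) [d]"
  have "perm_eq S Ss (D @ (\<Gamma> @ [x]) @ xs @ \<Gamma>', conjn S A B)
      (conj_with ((\<Gamma> @ [x]) @ xs @ \<Gamma>') (weaken (\<Gamma> @ [x]) xs \<Gamma>' B ?d))
      (weaken (D @ \<Gamma> @ [x]) xs \<Gamma>' (conjn S A B) (conj_with ((\<Gamma> @ [x]) @ \<Gamma>') ?d))"
    using Cons.prems by (intro Cons.IH) (simp add: derives_weak_iff)
  moreover have "perm_eq S Ss ((D @ \<Gamma> @ [x]) @ \<Gamma>', conjn S A B) (conj_with ((\<Gamma> @ [x]) @ \<Gamma>') ?d)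
      (Rule (weak_inst (D @ \<Gamma>) x \<Gamma>' (conjn S A B)) [conj_with (\<Gamma> @ \<Gamma>') d])"
    using Cons.prems e free_perm_andR_weak
    by (intro perm_eq.switch) (simp_all add: derives_andR_iff derives_weak_iff)
  from perm_eq_weaken[OF this, of xs] have "perm_eq S Ss (D @ (\<Gamma> @ [x]) @ xs @ \<Gamma>', conjn S A B)
      (weaken (D @ \<Gamma> @ [x]) xs \<Gamma>' (conjn S A B) (conj_with ((\<Gamma> @ [x]) @ \<Gamma>') ?d))
      (weaken (D @ \<Gamma>) (x # xs) \<Gamma>' (conjn S A B) (conj_with (\<Gamma> @ \<Gamma>') d))"
    by simp
  ultimately have "perm_eq S Ss (D @ (\<Gamma> @ [x]) @ xs @ \<Gamma>', conjn S A B)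
      (conj_with ((\<Gamma> @ [x]) @ xs @ \<Gamma>') (weaken (\<Gamma> @ [x]) xs \<Gamma>' B ?d))
      (weaken (D @ \<Gamma>) (x # xs) \<Gamma>' (conjn S A B) (conj_with (\<Gamma> @ \<Gamma>') d))"
    by (rule perm_eq.trans)
  then show ?case by simp
qed

lemma conj_with_contract:
  "derives S Ss d (\<Gamma> @ xs @ xs @ \<Gamma>', B) \<Longrightarrow>
   perm_eq S Ss (D @ \<Gamma> @ xs @ \<Gamma>', conjn S A B) (conj_with (\<Gamma> @ xs @ \<Gamma>') (contract \<Gamma> xs \<Gamma>' B d))
     (contract (D @ \<Gamma>) xs \<Gamma>' (conjn S A B) (conj_with (\<Gamma> @ xs @ xs @ \<Gamma>') d))"
proof (induction xs arbitrary: \<Gamma> d)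
  case Nil
  then show ?case using e by (simp add: perm_eq_refl derives_andR_iff)
next
  case (Cons x xs)
  let ?d = "Rule (contr_inst \<Gamma> x xs (xs @ \<Gamma>') B) [d]"
  have "perm_eq S Ss (D @ (\<Gamma> @ [x]) @ xs @ \<Gamma>', conjn S A B)
      (conj_with ((\<Gamma> @ [x]) @ xs @ \<Gamma>') (contract (\<Gamma> @ [x]) xs \<Gamma>' B ?d))
      (contract (D @ \<Gamma> @ [x]) xs \<Gamma>' (conjn S A B) (conj_with ((\<Gamma> @ [x]) @ xs @ xs @ \<Gamma>') ?d))"
    using Cons.prems by (intro Cons.IH) (simp add: derives_contr_iff)
  moreover have "perm_eq S Ss ((D @ \<Gamma> @ [x]) @ xs @ xs @ \<Gamma>', conjn S A B)
      (conj_with ((\<Gamma> @ [x]) @ xs @ xs @ \<Gamma>') ?d)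
      (Rule (contr_inst (D @ \<Gamma>) x xs (xs @ \<Gamma>') (conjn S A B)) [conj_with (\<Gamma> @ (x # xs) @ (x # xs) @ \<Gamma>') d])"
    using Cons.prems e free_perm_andR_contr[of _ D A \<Gamma> x xs "xs @ \<Gamma>'"]
    by (intro perm_eq.switch) (simp_all add: derives_andR_iff derives_contr_iff)
  from perm_eq_contract[OF this] have "perm_eq S Ss (D @ (\<Gamma> @ [x]) @ xs @ \<Gamma>', conjn S A B)
      (contract (D @ \<Gamma> @ [x]) xs \<Gamma>' (conjn S A B) (conj_with ((\<Gamma> @ [x]) @ xs @ xs @ \<Gamma>') ?d))
      (contract (D @ \<Gamma>) (x # xs) \<Gamma>' (conjn S A B) (conj_with (\<Gamma> @ (x # xs) @ (x # xs) @ \<Gamma>') d))"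
    by simp
  ultimately have "perm_eq S Ss (D @ (\<Gamma> @ [x]) @ xs @ \<Gamma>', conjn S A B)
      (conj_with ((\<Gamma> @ [x]) @ xs @ \<Gamma>') (contract (\<Gamma> @ [x]) xs \<Gamma>' B ?d))
      (contract (D @ \<Gamma>) (x # xs) \<Gamma>' (conjn S A B) (conj_with (\<Gamma> @ (x # xs) @ (x # xs) @ \<Gamma>') d))"
    by (rule perm_eq.trans)
  then show ?case by simp
qed

text \<open>The cases are those of \<open>contract_copies\<close>: a weakening for no copy, nothing
  to do for one copy, and otherwise a contraction of the first two copies that leaves one copy
  less.\<close>

lemma conj_with_contract_copies:
  "derives S Ss d (\<Gamma> @ concat (replicate n E), B) \<Longrightarrow>
   perm_eq S Ss (D @ \<Gamma> @ E, conjn S A B) (conj_with (\<Gamma> @ E) (contract_copies \<Gamma> E n B d))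
     (contract_copies (D @ \<Gamma>) E n (conjn S A B) (conj_with (\<Gamma> @ concat (replicate n E)) d))"
proof (induction n arbitrary: d rule: nat_less_induct)
  case (1 n)
  consider "n = 0" | "n = 1" | m where "n = Suc (Suc m)"
    by (metis One_nat_def not0_implies_Suc)
  then show ?case
  proof cases
    case 1
    then show ?thesis using conj_with_weaken[of d \<Gamma> "[]" E] \<open>derives S Ss d _\<close> by simp
  next
    case 2
    then show ?thesis using e \<open>derives S Ss d _\<close> by (simp add: perm_eq_refl derives_andR_iff)
  next
    case 3
    let ?R = "concat (replicate m E)"
    have d: "derives S Ss d (\<Gamma> @ E @ E @ ?R, B)"
      using "1.prems" 3 by simp
    let ?d = "contract \<Gamma> E ?R B d"
    have "perm_eq S Ss (D @ \<Gamma> @ E, conjn S A B) (conj_with (\<Gamma> @ E) (contract_copies \<Gamma> E (Suc m) B ?d))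
        (contract_copies (D @ \<Gamma>) E (Suc m) (conjn S A B) (conj_with (\<Gamma> @ concat (replicate (Suc m) E)) ?d))"
      using 3 derives_contract[OF d] by (intro "1.IH"[rule_format]) simp_all
    \<comment> \<open>The contraction of the first two copies is innermost and is therefore passed
      last, inside the remaining ones.\<close>
    moreover have "perm_eq S Ss ((D @ \<Gamma>) @ E, conjn S A B)
        (contract_copies (D @ \<Gamma>) E (Suc m) (conjn S A B) (conj_with (\<Gamma> @ concat (replicate (Suc m) E)) ?d))
        (contract_copies (D @ \<Gamma>) E (Suc m) (conjn S A B)
          (contract (D @ \<Gamma>) E ?R (conjn S A B) (conj_with (\<Gamma> @ E @ E @ ?R) d)))"
      using conj_with_contract[OF d] by (intro perm_eq_contract_copies) simp
    ultimately show ?thesis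
      using 3 by (auto intro: perm_eq.trans)
  qed
qed

text \<open>Contrary to \<open>weaken\<close>, the head of the list is treated by the outermost
  rule. This cut is switched first, and the induction hypothesis then acts above its right
  premise.\<close>

lemma conj_with_cuts:
  "list_all2 (\<lambda>\<pi> X. derives S Ss \<pi> (E, X)) \<Theta> F \<Longrightarrow> derives S Ss d (\<Gamma> @ F, B) \<Longrightarrow>
   perm_eq S Ss (D @ \<Gamma> @ concat (replicate (length F) E), conjn S A B)
     (conj_with (\<Gamma> @ concat (replicate (length F) E)) (cuts E \<Gamma> F \<Theta> B d))
     (cuts E (D @ \<Gamma>) F \<Theta> (conjn S A B) (conj_with (\<Gamma> @ F) d))"
proof (induction \<Theta> F arbitrary: \<Gamma> rule: list_all2_induct)
  case Nil
  then show ?case using e by (simp add: perm_eq_refl derives_andR_iff)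
next
  case (Cons \<pi> \<Theta> X F)
  let ?R = "concat (replicate (length F) E)"
  let ?c = "cuts E (\<Gamma> @ [X]) F \<Theta> B d"
  let ?cut = "cut_inst E (D @ \<Gamma>) X ?R (conjn S A B)"
  have c: "derives S Ss ?c (\<Gamma> @ X # ?R, B)"
    using derives_cuts[of S Ss E \<Theta> F d "\<Gamma> @ [X]" B] Cons by simp
  have "perm_eq S Ss (D @ \<Gamma> @ E @ ?R, conjn S A B)
      (conj_with (\<Gamma> @ E @ ?R) (Rule (cut_inst E \<Gamma> X ?R B) [\<pi>, ?c])) (Rule ?cut [\<pi>, conj_with (\<Gamma> @ X # ?R) ?c])"
    using c e Cons.hyps free_perm_andR_cut
    by (intro perm_eq.switch) (simp_all add: derives_andR_iff derives_cut_iff)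
  moreover have "perm_eq S Ss ((D @ \<Gamma>) @ E @ ?R, conjn S A B) (Rule ?cut [\<pi>, conj_with (\<Gamma> @ X # ?R) ?c])
      (Rule ?cut [\<pi>, cuts E (D @ \<Gamma> @ [X]) F \<Theta> (conjn S A B) (conj_with (\<Gamma> @ X # F) d)])"
    using Cons.IH[of "\<Gamma> @ [X]"] Cons.prems Cons.hyps by (intro perm_eq_cut perm_eq_refl) simp_all
  ultimately show ?case by (auto intro: perm_eq.trans)
qed

lemma conj_with_cut_contract:
  assumes "list_all2 (\<lambda>\<pi> X. derives S Ss \<pi> (E, X)) \<Theta> F" "derives S Ss d (\<Gamma> @ F, B)"
  shows "perm_eq S Ss (D @ \<Gamma> @ E, conjn S A B)
     (conj_with (\<Gamma> @ E) (cut_contract \<Gamma> E F \<Theta> B d))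
     (cut_contract (D @ \<Gamma>) E F \<Theta> (conjn S A B) (conj_with (\<Gamma> @ F) d))"
proof (rule perm_eq.trans)
  show "perm_eq S Ss (D @ \<Gamma> @ E, conjn S A B)
     (conj_with (\<Gamma> @ E) (cut_contract \<Gamma> E F \<Theta> B d))
     (contract_copies (D @ \<Gamma>) E (length F) (conjn S A B)
       (conj_with (\<Gamma> @ concat (replicate (length F) E)) (cuts E \<Gamma> F \<Theta> B d)))"
    unfolding cut_contract_def by (intro conj_with_contract_copies derives_cuts assms)
  show "perm_eq S Ss (D @ \<Gamma> @ E, conjn S A B)
     (contract_copies (D @ \<Gamma>) E (length F) (conjn S A B)
       (conj_with (\<Gamma> @ concat (replicate (length F) E)) (cuts E \<Gamma> F \<Theta> B d)))
     (cut_contract (D @ \<Gamma>) E F \<Theta> (conjn S A B) (conj_with (\<Gamma> @ F) d))"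
    using perm_eq_contract_copies[of S Ss "D @ \<Gamma>" "length F" E] conj_with_cuts[OF assms]
    by (simp add: cut_contract_def)
qed

end

section \<open>Naturality of the conjunction rule\<close>

lemma andR_natural:
  assumes "\<Theta> \<in> hom (Contexts S) E F"
  shows "perm_eq S [(D, A), (F, B)] (D @ E, conjn S A B)
    (compose [[(D, A), (F, B)]] (farr (Phi D (conjn S A B)) F E \<Theta>) [andR S A B D F])
    (compose [[(D, A)], [(F, B)]] (andR S A B D E) [Ext 0, farr (Phi [] B) F E \<Theta>])"
proof -
  let ?Ss = "[(D, A), (F, B)]"
  have \<Theta>: "list_all2 (\<lambda>\<pi> X. derives S [] \<pi> (E, X)) \<Theta> F"
    using assms by (simp add: Contexts_def)
  then have \<Theta>': "list_all2 (\<lambda>\<pi> X. derives S ?Ss \<pi> (E, X)) \<Theta> F"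
    by (auto simp: derives_closed elim: list_all2_mono)
  \<comment> \<open>Both composites evaluate to the sides of this equivalence, since substitution
    passes through \<open>cut_contract\<close>. The axiom \<open>Ext 0\<close> of
    \<open>Phi [] B\<close> becomes \<open>Ext 1\<close> because \<open>(D, A)\<close> precedes it;
    \<open>[]\<close> is the initial prefix \<open>\<Gamma>\<close>.\<close>
  have "perm_eq S ?Ss (D @ [] @ E, conjn S A B)
      (Rule (andR_inst (conjn S A B) D A ([] @ E) B) [Ext 0, cut_contract [] E F \<Theta> B (Ext 1)])
      (cut_contract (D @ []) E F \<Theta> (conjn S A B)
        (Rule (andR_inst (conjn S A B) D A ([] @ F) B) [Ext 0, Ext 1]))"
    using \<Theta>' by (intro conj_with_cut_contract) (simp_all add: derives_Ext_iff)
  then show ?thesis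
    by (simp add: perm_eq.sym compose_def Phi_def andR_def subst_cut_contract[OF \<Theta>])
qed

theorem proposition1:
  fixes S :: "('f, 'r) calculus" and A B :: 'f
  assumes "sequent_calculus S"
  shows
    "(\<forall>D E F. \<forall>\<Theta> \<in> hom (Contexts S) E F.
        meq (MultiSequents_perm S) [(D, A), (F, B)] (D @ E, conjn S A B)
          (mcomp (MultiSequents_perm S) [[(D, A), (F, B)]]
             (farr (Phi D (conjn S A B)) F E \<Theta>) [andR S A B D F])
          (mcomp (MultiSequents_perm S) [[(D, A)], [(F, B)]]
             (andR S A B D E) [mident (MultiSequents_perm S) (D, A), farr (Phi [] B) F E \<Theta>]))
     \<and>
     (is_category (Contexts S) \<longrightarrow>
      preserves_composition (opposite (Contexts S)) (MultiSequents_perm S) (Phi [] B) \<longrightarrow>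
      (\<forall>D. preserves_composition (opposite (Contexts S)) (MultiSequents_perm S) (Phi D (conjn S A B)) \<longrightarrow>
         is_natural_transformation (opposite (Contexts S)) (MultiSequents_perm S)
           [const_functor (MultiSequents_perm S) (D, A), Phi [] B]
           (Phi D (conjn S A B))
           (andR S A B D)))"
proof (intro conjI allI ballI impI)
  fix D E F \<Theta> assume "\<Theta> \<in> hom (Contexts S) E F"
  then show "meq (MultiSequents_perm S) [(D, A), (F, B)] (D @ E, conjn S A B)
      (mcomp (MultiSequents_perm S) [[(D, A), (F, B)]]
        (farr (Phi D (conjn S A B)) F E \<Theta>) [andR S A B D F])
      (mcomp (MultiSequents_perm S) [[(D, A)], [(F, B)]]
        (andR S A B D E) [mident (MultiSequents_perm S) (D, A), farr (Phi [] B) F E \<Theta>])"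
    by (simp add: MultiSequents_perm_simps andR_natural)
next
  fix D
  assume C: "is_category (Contexts S)"
    and B: "preserves_composition (opposite (Contexts S)) (MultiSequents_perm S) (Phi [] B)"
    and AB: "preserves_composition (opposite (Contexts S)) (MultiSequents_perm S) (Phi D (conjn S A B))"
  \<comment> \<open>An arrow from \<open>X\<close> to \<open>Y\<close> in the opposite category is a
    list of derivations from \<open>Y\<close> to \<open>X\<close>, so \<open>X\<close> takes the
    place of \<open>F\<close> and \<open>Y\<close> that of \<open>E\<close>. Naturality states the
    equation with its sides exchanged.\<close>
  have "perm_eq S [(D, A), (X, B)] (D @ Y, conjn S A B)
      (compose [[(D, A)], [(X, B)]] (andR S A B D Y) [Ext 0, farr (Phi [] B) X Y \<Theta>])
      (compose [[(D, A), (X, B)]] (farr (Phi D (conjn S A B)) X Y \<Theta>) [andR S A B D X])"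
    if "\<Theta> \<in> hom (Contexts S) Y X" for X Y \<Theta>
    using andR_natural[OF that] by (rule perm_eq.sym)
  moreover have "derives S [(D, A), (X, B)] (andR S A B D X) (D @ X, conjn S A B)" for X
    by (simp add: andR_def derives_andR_iff derives_Ext_iff)
  moreover have "is_functor (opposite (Contexts S)) (MultiSequents_perm S)
      (const_functor (MultiSequents_perm S) (D, A))"
    using assms C by (intro is_functor_const is_category_opposite is_multicategory_MultiSequents_perm)
  ultimately show "is_natural_transformation (opposite (Contexts S)) (MultiSequents_perm S)
      [const_functor (MultiSequents_perm S) (D, A), Phi [] B] (Phi D (conjn S A B)) (andR S A B D)"
    using is_functor_Phi[OF assms C B] is_functor_Phi[OF assms C AB]
    by (simp add: is_natural_transformation_def MultiSequents_perm_simps const_functor_def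
        opposite_def Phi_def)
qed

end
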